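(* Let $(G,V)$ be an orthogonal representation of a compact Lie group $G$ on a Euclidean space $V$ admitting a $k$-section $\Sigma$, and let $G_\Sigma=\{g\in G: g\Sigma=\Sigma\}$ be the stabilizer of $\Sigma$. Then the inclusion $\Sigma\to V$ induces a homeomorphism $\Sigma/G_\Sigma\to V/G$ between the orbit spaces.
   Context: An orthogonal representation $(G,V)$ is a linear isometric action of a compact Lie group $G$ on a finite-dimensional Euclidean space $V$. A point is called $G$-regular if it lies on a principal orbit. For a nonnegative integer $k$, a $k$-section of $(G,V)$ is a connected, complete submanifold $\Sigma$ of $V$ such that: (C1) $\Sigma$ is totally geodesic in $V$; (C2) $\Sigma$ intersects all $G$-orbits; (C3) for every $G$-regular point $p\in\Sigma$, $T_p\Sigma$ contains the normal space $\nu_p(Gp)$ of the orbit as a subspace of codimension $k$; (C4) for every $G$-regular point $p\in\Sigma$, if $gp\in\Sigma$ for some $g\in G$, then $g\Sigma=\Sigma$. The $k$-section is not assumed to be minimal. *)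

theory Defs
  imports "HOL-Analysis.Analysis" "HOL-Algebra.Group_Action"
begin

section \<open>Smooth maps\<close>

text \<open>The following predicates are meant for open sets \<open>U\<close>.\<close>

primrec Ck_on :: "nat \<Rightarrow> 'a::real_normed_vector set \<Rightarrow> ('a \<Rightarrow> 'b::real_normed_vector) \<Rightarrow> bool" where
  "Ck_on 0 U f \<longleftrightarrow> continuous_on U f"
| "Ck_on (Suc n) U f \<longleftrightarrow>
     (\<forall>x\<in>U. f differentiable (at x)) \<and> (\<forall>v. Ck_on n U (\<lambda>x. frechet_derivative f (at x) v))"

definition smooth_on :: "'a::real_normed_vector set \<Rightarrow> ('a \<Rightarrow> 'b::real_normed_vector) \<Rightarrow> bool" where
  "smooth_on U f \<longleftrightarrow> (\<forall>n. Ck_on n U f)"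

text \<open>Smoothness on an arbitrary set: local extendability to a smooth map. On a relatively open
  subset of a linear subspace this is smoothness on that subspace.\<close>

definition smooth_ext_on :: "'a::real_normed_vector set \<Rightarrow> ('a \<Rightarrow> 'b::real_normed_vector) \<Rightarrow> bool" where
  "smooth_ext_on S f \<longleftrightarrow>
     (\<forall>x\<in>S. \<exists>U F. open U \<and> x \<in> U \<and> smooth_on U F \<and> (\<forall>y\<in>S \<inter> U. F y = f y))"

definition diffeomorphism_on :: "'a::real_normed_vector set \<Rightarrow> ('a \<Rightarrow> 'a) \<Rightarrow> bool" where
  "diffeomorphism_on N \<phi> \<longleftrightarrow>
     open N \<and> open (\<phi> ` N) \<and> inj_on \<phi> N \<and> smooth_on N \<phi> \<and> smooth_on (\<phi> ` N) (inv_into N \<phi>)"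


section \<open>Lie groups and orthogonal representations\<close>

text \<open>The model space is a linear subspace \<open>L\<close> of a Euclidean space, rather than the whole
  space, so that manifolds of dimension 0 (finite groups) are included.\<close>

definition smooth_atlas :: "'g topology \<Rightarrow> 'e::euclidean_space set \<Rightarrow> ('g set \<times> ('g \<Rightarrow> 'e)) set \<Rightarrow> bool" where
  "smooth_atlas T L \<A> \<longleftrightarrow>
     subspace L \<and> (\<Union>(U, \<phi>)\<in>\<A>. U) = topspace T \<and>
     (\<forall>(U, \<phi>)\<in>\<A>. openin T U \<and> openin (top_of_set L) (\<phi> ` U) \<and>
        homeomorphic_map (subtopology T U) (top_of_set (\<phi> ` U)) \<phi>) \<and>
     (\<forall>(U, \<phi>)\<in>\<A>. \<forall>(W, \<psi>)\<in>\<A>. smooth_ext_on (\<phi> ` (U \<inter> W)) (\<psi> \<circ> inv_into U \<phi>))"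

definition lie_group ::
  "('g, 'm) monoid_scheme \<Rightarrow> 'g topology \<Rightarrow> 'e::euclidean_space set \<Rightarrow> ('g set \<times> ('g \<Rightarrow> 'e)) set \<Rightarrow> bool" where
  "lie_group G T L \<A> \<longleftrightarrow>
     group G \<and> topspace T = carrier G \<and> Hausdorff_space T \<and> second_countable T \<and>
     smooth_atlas T L \<A> \<and>
     continuous_map (prod_topology T T) T (\<lambda>(g, h). g \<otimes>\<^bsub>G\<^esub> h) \<and>
     (\<forall>(U, \<phi>)\<in>\<A>. \<forall>(W, \<psi>)\<in>\<A>. \<forall>(Z, \<eta>)\<in>\<A>.
        smooth_ext_on {(\<phi> g, \<psi> h) | g h. g \<in> U \<and> h \<in> W \<and> g \<otimes>\<^bsub>G\<^esub> h \<in> Z}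
          (\<lambda>(x, y). \<eta> (inv_into U \<phi> x \<otimes>\<^bsub>G\<^esub> inv_into W \<psi> y))) \<and>
     continuous_map T T (\<lambda>g. inv\<^bsub>G\<^esub> g) \<and>
     (\<forall>(U, \<phi>)\<in>\<A>. \<forall>(W, \<psi>)\<in>\<A>.
        smooth_ext_on {\<phi> g | g. g \<in> U \<and> inv\<^bsub>G\<^esub> g \<in> W} (\<lambda>x. \<psi> (inv\<^bsub>G\<^esub> (inv_into U \<phi> x))))"

definition orthogonal_representation ::
  "('g, 'm) monoid_scheme \<Rightarrow> 'g topology \<Rightarrow> ('g \<Rightarrow> 'a::euclidean_space \<Rightarrow> 'a) \<Rightarrow> bool" where
  "orthogonal_representation G T \<rho> \<longleftrightarrow>
     group_action G UNIV \<rho> \<and>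
     (\<forall>g\<in>carrier G. orthogonal_transformation (\<rho> g)) \<and>
     continuous_map (prod_topology T euclidean) euclidean (\<lambda>(g, v). \<rho> g v)"

text \<open>A point is regular if its orbit is principal, i.e. of maximal orbit type: its isotropy group
  is conjugate to a subgroup of every isotropy group.\<close>

definition regular_point :: "('g, 'm) monoid_scheme \<Rightarrow> ('g \<Rightarrow> 'a \<Rightarrow> 'a) \<Rightarrow> 'a \<Rightarrow> bool" where
  "regular_point G \<rho> p \<longleftrightarrow>
     (\<forall>q. \<exists>g\<in>carrier G.
        (\<lambda>h. g \<otimes>\<^bsub>G\<^esub> h \<otimes>\<^bsub>G\<^esub> inv\<^bsub>G\<^esub> g) ` stabilizer G \<rho> p \<subseteq> stabilizer G \<rho> q)"

definition set_stabilizer :: "('g, 'm) monoid_scheme \<Rightarrow> ('g \<Rightarrow> 'a \<Rightarrow> 'a) \<Rightarrow> 'a set \<Rightarrow> 'g set" where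
  "set_stabilizer G \<rho> S = {g \<in> carrier G. \<rho> g ` S = S}"


section \<open>Submanifolds of a Euclidean space\<close>

text \<open>A submanifold is given by a topology \<open>X\<close> whose \<open>topspace\<close> is the underlying set; it may be
  finer than the subspace topology. Thus (injectively) immersed submanifolds are covered, the
  embedded ones being those with \<open>X = top_of_set (topspace X)\<close>. The conditions on \<open>W\<close> say that
  \<open>X\<close> is locally an embedded \<open>m\<close>-dimensional submanifold, given by a slice chart.\<close>

definition submanifold :: "'a::euclidean_space topology \<Rightarrow> nat \<Rightarrow> bool" where
  "submanifold X m \<longleftrightarrow>
     Hausdorff_space X \<and> second_countable X \<and>
     (\<forall>p\<in>topspace X. \<exists>W N \<phi> L.
        openin X W \<and> p \<in> W \<and> subtopology X W = top_of_set W \<and>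
        diffeomorphism_on N \<phi> \<and> subspace L \<and> dim L = m \<and>
        W \<subseteq> N \<and> \<phi> ` W = \<phi> ` N \<inter> L)"

definition smooth_curve :: "'a::euclidean_space topology \<Rightarrow> real set \<Rightarrow> (real \<Rightarrow> 'a) \<Rightarrow> bool" where
  "smooth_curve X I \<gamma> \<longleftrightarrow>
     open I \<and> is_interval I \<and> continuous_map (top_of_set I) X \<gamma> \<and> smooth_on I \<gamma>"

definition tangent_space :: "'a::euclidean_space topology \<Rightarrow> 'a \<Rightarrow> 'a set" where
  "tangent_space X p =
     {vector_derivative \<gamma> (at 0) | \<gamma> I. smooth_curve X I \<gamma> \<and> 0 \<in> I \<and> \<gamma> 0 = p}"

definition normal_space :: "'a::euclidean_space topology \<Rightarrow> 'a \<Rightarrow> 'a set" where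
  "normal_space X p = (tangent_space X p)\<^sup>\<bottom>"

definition acceleration :: "(real \<Rightarrow> 'a::real_normed_vector) \<Rightarrow> real \<Rightarrow> 'a" where
  "acceleration \<gamma> t = vector_derivative (\<lambda>s. vector_derivative \<gamma> (at s)) (at t)"

text \<open>The Levi-Civita connection of the induced metric is the tangential part of the derivative
  in the ambient space, so geodesics are the curves with normal acceleration.\<close>

definition geodesic :: "'a::euclidean_space topology \<Rightarrow> real set \<Rightarrow> (real \<Rightarrow> 'a) \<Rightarrow> bool" where
  "geodesic X I \<gamma> \<longleftrightarrow>
     smooth_curve X I \<gamma> \<and> (\<forall>t\<in>I. acceleration \<gamma> t \<in> normal_space X (\<gamma> t))"

text \<open>Completeness with respect to the induced Riemannian metric: every tangent vector is the
  initial velocity of a geodesic defined for all times.\<close>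

definition geodesically_complete :: "'a::euclidean_space topology \<Rightarrow> bool" where
  "geodesically_complete X \<longleftrightarrow>
     (\<forall>p\<in>topspace X. \<forall>v\<in>tangent_space X p.
        \<exists>\<gamma>. geodesic X UNIV \<gamma> \<and> \<gamma> 0 = p \<and> vector_derivative \<gamma> (at 0) = v)"

definition totally_geodesic :: "'a::euclidean_space topology \<Rightarrow> bool" where
  "totally_geodesic X \<longleftrightarrow> (\<forall>I \<gamma>. geodesic X I \<gamma> \<longrightarrow> geodesic euclidean I \<gamma>)"

lemma tangent_space_euclidean: "tangent_space euclidean p = (UNIV :: 'a::euclidean_space set)"
proof -
  have "v \<in> tangent_space euclidean p" for v :: 'a
  proof -
    define \<gamma> where "\<gamma> = (\<lambda>t::real. p + t *\<^sub>R v)"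
    have d: "(\<gamma> has_derivative (\<lambda>h. h *\<^sub>R v)) (at t)" for t
      unfolding \<gamma>_def by (auto intro!: derivative_eq_intros)
    have fd: "frechet_derivative \<gamma> (at t) = (\<lambda>h. h *\<^sub>R v)" for t
      using frechet_derivative_at[OF d] by simp
    have const: "Ck_on n UNIV (\<lambda>t::real. c)" for n and c :: 'a
      by (induction n arbitrary: c) (simp_all add: frechet_derivative_const)
    have "Ck_on n UNIV \<gamma>" for n
    proof (cases n)
      case 0
      then show ?thesis by (simp add: \<gamma>_def continuous_intros)
    next
      case (Suc m)
      then show ?thesis using d const by (auto simp: fd differentiable_def)
    qed
    then have "smooth_curve euclidean UNIV \<gamma>"
      by (auto simp: smooth_curve_def smooth_on_def \<gamma>_def intro!: continuous_intros)
    moreover have "vector_derivative \<gamma> (at 0) = v"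
      using d[of 0] by (auto simp: has_vector_derivative_def intro: vector_derivative_at)
    moreover have "\<gamma> 0 = p" by (simp add: \<gamma>_def)
    ultimately show ?thesis unfolding tangent_space_def by blast
  qed
  then show ?thesis by blast
qed

lemma geodesic_euclidean:
  "geodesic euclidean I \<gamma> \<longleftrightarrow> smooth_curve euclidean I \<gamma> \<and> (\<forall>t\<in>I. acceleration \<gamma> t = 0)"
  by (simp add: geodesic_def normal_space_def tangent_space_euclidean)


section \<open>\<open>k\<close>-sections\<close>

definition k_section ::
  "('g, 'm) monoid_scheme \<Rightarrow> ('g \<Rightarrow> 'a::euclidean_space \<Rightarrow> 'a) \<Rightarrow> nat \<Rightarrow> 'a topology \<Rightarrow> bool" where
  "k_section G \<rho> k X \<longleftrightarrow>
     (\<exists>m. submanifold X m) \<and> connected_space X \<and> geodesically_complete X \<and>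
     totally_geodesic X \<and>
     (\<forall>v. orbit G \<rho> v \<inter> topspace X \<noteq> {}) \<and>
     (\<forall>p\<in>topspace X. regular_point G \<rho> p \<longrightarrow>
        normal_space (top_of_set (orbit G \<rho> p)) p \<subseteq> tangent_space X p \<and>
        dim (tangent_space X p) = dim (normal_space (top_of_set (orbit G \<rho> p)) p) + k) \<and>
     (\<forall>p\<in>topspace X. regular_point G \<rho> p \<longrightarrow>
        (\<forall>g\<in>carrier G. \<rho> g p \<in> topspace X \<longrightarrow> \<rho> g ` topspace X = topspace X))"


section \<open>Orbit spaces\<close>

text \<open>The set of orbits of points of \<open>X\<close> with the quotient topology.\<close>

definition orbit_space ::
  "('g, 'm) monoid_scheme \<Rightarrow> ('g \<Rightarrow> 'a \<Rightarrow> 'a) \<Rightarrow> 'a topology \<Rightarrow> 'a set topology" where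
  "orbit_space G \<rho> X = topology (\<lambda>\<U>. \<U> \<subseteq> orbits G (topspace X) \<rho> \<and>
     openin X {x \<in> topspace X. orbit G \<rho> x \<in> \<U>})"

lemma openin_orbit_space:
  "openin (orbit_space G \<rho> X) \<U> \<longleftrightarrow>
     \<U> \<subseteq> orbits G (topspace X) \<rho> \<and> openin X {x \<in> topspace X. orbit G \<rho> x \<in> \<U>}"
proof -
  let ?P = "\<lambda>\<U>. {x \<in> topspace X. orbit G \<rho> x \<in> \<U>}"
  have "istopology (\<lambda>\<U>. \<U> \<subseteq> orbits G (topspace X) \<rho> \<and> openin X (?P \<U>))"
    unfolding istopology_def
  proof (intro conjI allI impI)
    fix A B assume *: "A \<subseteq> orbits G (topspace X) \<rho> \<and> openin X (?P A)"
      "B \<subseteq> orbits G (topspace X) \<rho> \<and> openin X (?P B)"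
    have "?P (A \<inter> B) = ?P A \<inter> ?P B" by blast
    then show "openin X (?P (A \<inter> B))" using * by auto
    show "A \<inter> B \<subseteq> orbits G (topspace X) \<rho>" using * by blast
  next
    fix \<K> assume *: "\<forall>K\<in>\<K>. K \<subseteq> orbits G (topspace X) \<rho> \<and> openin X (?P K)"
    have "?P (\<Union>\<K>) = (\<Union>K\<in>\<K>. ?P K)" by blast
    then show "openin X (?P (\<Union>\<K>))" using * by auto
    show "\<Union>\<K> \<subseteq> orbits G (topspace X) \<rho>" using * by blast
  qed
  then show ?thesis unfolding orbit_space_def by simp
qed

lemma topspace_orbit_space: "topspace (orbit_space G \<rho> X) = orbits G (topspace X) \<rho>"
proof -
  have "{x \<in> topspace X. orbit G \<rho> x \<in> orbits G (topspace X) \<rho>} = topspace X"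
    by (auto simp: orbits_def)
  then have "openin (orbit_space G \<rho> X) (orbits G (topspace X) \<rho>)"
    by (simp add: openin_orbit_space)
  then show ?thesis
    by (meson openin_orbit_space openin_subset openin_topspace subset_antisym)
qed

lemma quotient_map_orbit_space: "quotient_map X (orbit_space G \<rho> X) (orbit G \<rho>)"
  unfolding quotient_map_def topspace_orbit_space openin_orbit_space
  by (auto simp: orbits_def)

end

theory Submission
  imports Defs
begin

text \<open>
  A complete connected totally geodesic submanifold of \<open>V\<close> is an affine subspace, and \<open>\<Sigma>\<close> meets the
  orbit \<open>{0}\<close>, so \<open>\<Sigma>\<close> is a linear subspace. The main point is that two points \<open>p\<close> and \<open>gp\<close> of \<open>\<Sigma>\<close>
  lie in one orbit of the stabilizer of \<open>\<Sigma>\<close>, also when they are singular. Let \<open>x\<close> and \<open>y\<close> be regular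
  points of \<open>\<Sigma>\<close> near \<open>p\<close> and \<open>gp\<close>, and let \<open>h\<close> minimize the distance from \<open>hx\<close> to \<open>g\<inverse>y\<close>. Then
  \<open>g\<inverse>y - hx\<close> is normal to the orbit at \<open>hx\<close>, so (C3) puts \<open>g\<inverse>y\<close> into \<open>h\<Sigma>\<close> and (C4) gives
  \<open>gh\<Sigma> = \<Sigma>\<close>. As \<open>x \<rightarrow> p\<close> and \<open>y \<rightarrow> gp\<close>, a limit of the elements \<open>gh\<close> maps \<open>p\<close> to \<open>gp\<close> and
  stabilizes \<open>\<Sigma>\<close>.

  This needs regular points to be dense in \<open>\<Sigma>\<close>. Given \<open>q \<in> \<Sigma>\<close>, let \<open>z\<close> be the point nearest to \<open>q\<close> in the
  intersection of \<open>\<Sigma>\<close> with a regular orbit. By transversality, \<open>q - z\<close> is normal to the whole orbit,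
  hence normal to the orbits of all points of the line through \<open>z\<close> and \<open>q\<close>. By a slice argument, the
  isotropy group of a point of this line near \<open>q\<close> lies in that of \<open>q\<close>; it then fixes the line
  pointwise, so it lies in that of \<open>z\<close> and the point is regular.
\<close>


section \<open>The exponential function in a Banach algebra\<close>

text \<open>The difference is the exponential series from degree two on. Pulling out two factors and
  using \<open>fact n \<le> fact (n + 2)\<close> leaves the series of \<open>exp (norm x)\<close>.
  This quadratic bound yields the derivative of \<open>exp\<close> at zero.\<close>

lemma norm_exp_minus_one_minus_le:
  fixes x :: "'b::{real_normed_algebra_1,banach}"
  shows "norm (exp x - 1 - x) \<le> (norm x)\<^sup>2 * exp (norm x)"
proof -
  let ?f = "\<lambda>n. x ^ n /\<^sub>R fact n"
  have sumf: "summable ?f" by (rule summable_exp_generic)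
  have sumg: "summable (\<lambda>n. norm x ^ n /\<^sub>R fact n)" by (rule summable_exp_generic)
  have "exp x = (\<Sum>n. ?f (n + 2)) + (\<Sum>n<2. ?f n)"
    unfolding exp_def by (rule suminf_split_initial_segment[OF sumf])
  then have "exp x - 1 - x = (\<Sum>n. ?f (n + 2))"
    by (simp add: numeral_2_eq_2)
  also have "norm \<dots> \<le> (\<Sum>n. (norm x)\<^sup>2 * (norm x ^ n /\<^sub>R fact n))"
  proof (rule norm_suminf_le)
    fix n
    have "norm (?f (n + 2)) = norm (x ^ (n + 2)) * inverse (fact (n + 2))"
      by (simp only: norm_scaleR) (simp add: mult.commute)
    also have "\<dots> \<le> norm x ^ (n + 2) * inverse (fact n)"
      by (intro mult_mono norm_power_ineq le_imp_inverse_le fact_mono) auto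
    also have "\<dots> = (norm x)\<^sup>2 * (norm x ^ n /\<^sub>R fact n)"
      by (simp add: power_add mult_ac power2_eq_square)
    finally show "norm (?f (n + 2)) \<le> (norm x)\<^sup>2 * (norm x ^ n /\<^sub>R fact n)" .
    show "summable (\<lambda>n. (norm x)\<^sup>2 * (norm x ^ n /\<^sub>R fact n))"
      by (intro summable_mult sumg)
  qed
  also have "\<dots> = (norm x)\<^sup>2 * exp (norm x)"
    unfolding exp_def by (rule suminf_mult[OF sumg])
  finally show ?thesis .
qed

text \<open>Telescoping. The factor \<open>M\<close> allows a joint bound on the powers of
  \<open>b\<close> even if \<open>norm b\<close> exceeds \<open>c\<close>, as can happen when
  \<open>exp (s *\<^sub>R A)\<close> is compared with a contraction.\<close>

lemma norm_power_diff_le: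
  fixes a b :: "'b::real_normed_algebra_1"
  assumes "norm a \<le> c" and "\<And>j. j < n \<Longrightarrow> norm (b ^ j) \<le> M * c ^ j"
  shows "norm (a ^ n - b ^ n) \<le> n * M * c ^ (n - 1) * norm (a - b)"
  using assms(2)
proof (induction n)
  case (Suc n)
  have c: "0 \<le> c" using assms(1) norm_ge_zero order.trans by blast
  have "norm (a ^ Suc n - b ^ Suc n) = norm (a * (a ^ n - b ^ n) + (a - b) * b ^ n)"
    by (simp add: algebra_simps)
  also have "\<dots> \<le> norm (a * (a ^ n - b ^ n)) + norm ((a - b) * b ^ n)"
    by (rule norm_triangle_ineq)
  also have "\<dots> \<le> c * (n * M * c ^ (n - 1) * norm (a - b)) + norm (a - b) * (M * c ^ n)"
  proof (rule add_mono)
    show "norm (a * (a ^ n - b ^ n)) \<le> c * (n * M * c ^ (n - 1) * norm (a - b))"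
      using assms(1) Suc c by (intro order.trans[OF norm_mult_ineq] mult_mono) auto
    show "norm ((a - b) * b ^ n) \<le> norm (a - b) * (M * c ^ n)"
      using Suc.prems by (intro order.trans[OF norm_mult_ineq] mult_mono) auto
  qed
  also have "\<dots> = Suc n * M * c ^ (Suc n - 1) * norm (a - b)"
    by (cases n) (simp_all add: algebra_simps)
  finally show ?case .
qed simp

lemma has_vector_derivative_imp_difference_quotient:
  assumes "(f has_vector_derivative v) (at x)"
    and "s \<longlonglongrightarrow> 0" and "\<And>n. s n \<noteq> (0::real)"
  shows "(\<lambda>n. (f (x + s n) - f x) /\<^sub>R s n) \<longlonglongrightarrow> v"
proof -
  have "((\<lambda>h. norm (f (x + h) - f x - h *\<^sub>R v) / norm h) \<longlongrightarrow> 0) (at 0)"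
    using assms(1) by (simp add: has_vector_derivative_def has_derivative_at)
  then have "(\<lambda>n. norm (f (x + s n) - f x - s n *\<^sub>R v) / norm (s n)) \<longlonglongrightarrow> 0"
    by (rule filterlim_compose) (use assms in \<open>auto simp: filterlim_at\<close>)
  moreover have "norm (f (x + s n) - f x - s n *\<^sub>R v) / norm (s n)
      = norm ((f (x + s n) - f x) /\<^sub>R s n - v)" for n
  proof -
    have "(f (x + s n) - f x) /\<^sub>R s n - v = (f (x + s n) - f x - s n *\<^sub>R v) /\<^sub>R s n"
      using assms(3)[of n] by (simp add: scaleR_diff_right)
    then show ?thesis by (simp add: divide_inverse mult.commute)
  qed
  ultimately have "(\<lambda>n. (f (x + s n) - f x) /\<^sub>R s n - v) \<longlonglongrightarrow> 0"
    by (simp only: tendsto_norm_zero_iff)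
  then show ?thesis by (rule LIM_zero_cancel)
qed

lemma exp_scaleR_of_nat: "exp ((real n * s) *\<^sub>R A) = exp (s *\<^sub>R A) ^ n"
  for A :: "'b::{real_normed_algebra_1,banach}"
proof (induction n)
  case (Suc n)
  have "exp ((real (Suc n) * s) *\<^sub>R A) = exp (s *\<^sub>R A + (real n * s) *\<^sub>R A)"
    by (simp add: algebra_simps)
  also have "\<dots> = exp (s *\<^sub>R A) * exp ((real n * s) *\<^sub>R A)"
    by (rule exp_add_commuting) simp
  finally show ?case by (simp add: Suc)
qed simp

lemma continuous_at_exp_scaleR: "isCont (\<lambda>t. exp (t *\<^sub>R A)) t"
  for A :: "'b::{real_normed_algebra_1,banach}"
  by (rule has_vector_derivative_continuous[OF exp_scaleR_has_vector_derivative_right])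

lemma exp_scaleR_difference_quotient:
  fixes A :: "'b::{real_normed_algebra_1,banach}"
  assumes "s \<longlonglongrightarrow> 0" and "\<And>n. s n \<noteq> (0::real)"
  shows "(\<lambda>n. (exp (s n *\<^sub>R A) - 1) /\<^sub>R s n) \<longlonglongrightarrow> A"
  using has_vector_derivative_imp_difference_quotient[OF _ assms, of "\<lambda>t. exp (t *\<^sub>R A)" A 0]
    exp_scaleR_has_vector_derivative_right[of A 0 UNIV] by simp

text \<open>A variant of the limit of \<open>(1 + A / n) ^ n\<close>. The elements
  \<open>m n\<close> and \<open>exp (s n *\<^sub>R A)\<close> agree up to an error of smaller order
  than \<open>s n\<close>, and telescoping over at most \<open>t / s n\<close> factors leaves an
  error that tends to zero.\<close>

lemma power_tendsto_exp:
  fixes A :: "'b::{real_normed_algebra_1,banach}" and m :: "nat \<Rightarrow> 'b"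
  assumes m: "\<And>n. norm (m n) \<le> 1" and s: "\<And>n. 0 < s n" "s \<longlonglongrightarrow> 0"
    and lim: "(\<lambda>n. (m n - 1) /\<^sub>R s n) \<longlonglongrightarrow> A" and t: "0 \<le> t"
  shows "(\<lambda>n. m n ^ nat \<lfloor>t / s n\<rfloor>) \<longlonglongrightarrow> exp (t *\<^sub>R A)"
proof -
  define k where "k = (\<lambda>n. nat \<lfloor>t / s n\<rfloor>)"
  have k: "real (k n) * s n \<le> t" "t - real (k n) * s n \<le> s n" for n
  proof -
    have "real (k n) = \<lfloor>t / s n\<rfloor>" using t s(1)[of n] by (simp add: k_def)
    then have "real (k n) \<le> t / s n" "t / s n < real (k n) + 1" by linarith+
    then show "real (k n) * s n \<le> t" "t - real (k n) * s n \<le> s n"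
      using s(1)[of n] by (auto simp: field_simps)
  qed
  have ks: "(\<lambda>n. real (k n) * s n) \<longlonglongrightarrow> t"
  proof (rule tendsto_sandwich)
    show "\<forall>\<^sub>F n in sequentially. t - s n \<le> real (k n) * s n"
      using k(2) by (intro always_eventually allI) (simp add: algebra_simps)
    show "\<forall>\<^sub>F n in sequentially. real (k n) * s n \<le> t" using k(1) by simp
    show "(\<lambda>n. t - s n) \<longlonglongrightarrow> t" using tendsto_diff[OF tendsto_const s(2), of t] by simp
  qed auto
  define e where "e = (\<lambda>n. exp (s n *\<^sub>R A))"
  have diff: "(\<lambda>n. (m n - e n) /\<^sub>R s n) \<longlonglongrightarrow> 0"
  proof -
    have "(\<lambda>n. (e n - 1) /\<^sub>R s n) \<longlonglongrightarrow> A"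
      unfolding e_def using s by (intro exp_scaleR_difference_quotient) (auto simp: less_imp_neq[symmetric])
    from tendsto_diff[OF lim this] show ?thesis by (simp add: algebra_simps)
  qed
  define M where "M = exp (t * norm A)"
  have "norm (m n ^ k n - e n ^ k n) \<le> M * t * norm ((m n - e n) /\<^sub>R s n)" for n
  proof -
    have "norm (e n ^ j) \<le> M" if "j < k n" for j
    proof -
      have "norm (e n ^ j) \<le> exp (norm ((real j * s n) *\<^sub>R A))"
        unfolding e_def exp_scaleR_of_nat[symmetric] by (rule norm_exp)
      also have "\<dots> \<le> M"
      proof -
        have "real j * s n \<le> real (k n) * s n" using that s(1)[of n] by (intro mult_right_mono) auto
        then have "real j * s n \<le> t" using k(1)[of n] by linarith
        then show ?thesis using s(1)[of n] by (simp add: M_def mult_right_mono abs_mult)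
      qed
      finally show ?thesis .
    qed
    then have "norm (m n ^ k n - e n ^ k n) \<le> k n * M * norm (m n - e n)"
      using norm_power_diff_le[OF m, of "k n" "e n" M n] by simp
    also have "\<dots> = M * (real (k n) * s n) * norm ((m n - e n) /\<^sub>R s n)"
      using s(1)[of n] by simp
    also have "\<dots> \<le> M * t * norm ((m n - e n) /\<^sub>R s n)"
      using k(1)[of n] by (intro mult_right_mono mult_left_mono) (auto simp: M_def)
    finally show ?thesis .
  qed
  moreover have "(\<lambda>n. M * t * norm ((m n - e n) /\<^sub>R s n)) \<longlonglongrightarrow> 0"
    by (intro tendsto_mult_right_zero tendsto_norm_zero diff)
  ultimately have "(\<lambda>n. m n ^ k n - e n ^ k n) \<longlonglongrightarrow> 0"
    by (rule Lim_null_comparison[OF always_eventually[OF allI]])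
  moreover have "(\<lambda>n. e n ^ k n) \<longlonglongrightarrow> exp (t *\<^sub>R A)"
    unfolding e_def exp_scaleR_of_nat[symmetric]
    by (rule isCont_tendsto_compose[OF continuous_at_exp_scaleR ks])
  ultimately show ?thesis
    using tendsto_add[of "\<lambda>n. m n ^ k n - e n ^ k n" 0 sequentially "\<lambda>n. e n ^ k n"] by (simp add: k_def)
qed

lemma exp_minus_unique_inverse:
  fixes A b :: "'b::{real_normed_algebra_1,banach}"
  assumes "exp A * b = 1"
  shows "exp (- A) = b"
proof -
  have "exp (- A) * exp A = 1" using exp_minus_inverse[of "- A"] by simp
  then show ?thesis using assms by (metis mult.assoc mult_1 mult_1_right)
qed

text \<open>A termwise estimate: the constant terms cancel, and the factor \<open>Suc n\<close> from
  \<open>norm_power_diff_le\<close> turns \<open>fact (Suc n)\<close> into \<open>fact n\<close>, so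
  that the series of \<open>exp M\<close> reappears.\<close>

lemma norm_exp_diff_le:
  fixes a b :: "'b::{real_normed_algebra_1,banach}"
  assumes "norm a \<le> M" and "norm b \<le> M"
  shows "norm (exp a - exp b) \<le> exp M * norm (a - b)"
proof -
  have bj: "norm (b ^ j) \<le> M ^ j" for j
    by (rule order.trans[OF norm_power_ineq power_mono[OF assms(2)]]) simp
  have sumM: "summable (\<lambda>n. M ^ n /\<^sub>R fact n)" by (rule summable_exp_generic)
  have f: "(\<lambda>n. (a ^ n - b ^ n) /\<^sub>R fact n) sums (exp a - exp b)"
    using sums_diff[OF exp_converges exp_converges, of a b] by (simp add: algebra_simps)
  have f0: "(\<lambda>n. (a ^ Suc n - b ^ Suc n) /\<^sub>R fact (Suc n)) sums (exp a - exp b)"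
    using f by (subst sums_Suc_iff) simp
  have "norm (exp a - exp b) = norm (\<Sum>n. (a ^ Suc n - b ^ Suc n) /\<^sub>R fact (Suc n))"
    by (simp only: sums_unique[OF f0])
  also have "\<dots> \<le> (\<Sum>n. norm (a - b) * (M ^ n /\<^sub>R fact n))"
  proof (rule norm_suminf_le)
    fix n
    have "norm ((a ^ Suc n - b ^ Suc n) /\<^sub>R fact (Suc n)) = norm (a ^ Suc n - b ^ Suc n) / fact (Suc n)"
      by (simp only: norm_scaleR) (simp add: divide_inverse mult.commute del: power_Suc fact_Suc)
    also have "\<dots> \<le> (Suc n * M ^ n * norm (a - b)) / fact (Suc n)"
      using norm_power_diff_le[OF assms(1), of "Suc n" b 1] bj
      by (intro divide_right_mono) auto
    also have "\<dots> = norm (a - b) * (M ^ n /\<^sub>R fact n)"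
      by (simp add: field_simps del: of_nat_Suc)
    finally show "norm ((a ^ Suc n - b ^ Suc n) /\<^sub>R fact (Suc n)) \<le> norm (a - b) * (M ^ n /\<^sub>R fact n)" .
  qed (intro summable_mult sumM)
  also have "\<dots> = norm (a - b) * exp M"
    unfolding exp_def by (rule suminf_mult[OF sumM])
  finally show ?thesis by (simp add: mult.commute)
qed

lemma isCont_exp_banach_algebra: "isCont exp a"
  for a :: "'b::{real_normed_algebra_1,banach}"
proof -
  have "((\<lambda>x. exp x - exp a) \<longlongrightarrow> 0) (at a)"
  proof (rule Lim_null_comparison)
    show "\<forall>\<^sub>F x in at a. norm (exp x - exp a) \<le> exp (norm a + 1) * norm (x - a)"
      unfolding eventually_at
    proof (intro exI[of _ 1] conjI ballI impI)
      fix x assume "x \<noteq> a \<and> dist x a < 1"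
      then have "norm x \<le> norm a + 1"
        using norm_triangle_ineq2[of x a] by (simp add: dist_norm)
      then show "norm (exp x - exp a) \<le> exp (norm a + 1) * norm (x - a)"
        by (rule norm_exp_diff_le) simp
    qed simp
    have "((\<lambda>x. exp (norm a + 1) * norm (x - a)) \<longlongrightarrow> exp (norm a + 1) * norm (a - a)) (at a)"
      by (intro tendsto_intros)
    then show "((\<lambda>x. exp (norm a + 1) * norm (x - a)) \<longlongrightarrow> 0) (at a)" by simp
  qed
  then show ?thesis unfolding isCont_def by (rule LIM_zero_cancel)
qed

lemma exp_has_derivative_at_zero: "((exp :: 'b::{real_normed_algebra_1,banach} \<Rightarrow> 'b) has_derivative (\<lambda>h. h)) (at 0)"
  unfolding has_derivative_at
proof
  show "bounded_linear (\<lambda>h :: 'b. h)" by (rule bounded_linear_ident)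
  show "((\<lambda>h :: 'b. norm (exp (0 + h) - exp 0 - h) / norm h) \<longlongrightarrow> 0) (at 0)"
  proof (rule Lim_null_comparison)
    have "norm (norm (exp (0 + h) - exp 0 - h) / norm h) \<le> norm h * exp (norm h)" if "h \<noteq> 0" for h :: 'b
      using norm_exp_minus_one_minus_le[of h] that by (simp add: field_simps power2_eq_square)
    then show "\<forall>\<^sub>F h :: 'b in at 0. norm (norm (exp (0 + h) - exp 0 - h) / norm h) \<le> norm h * exp (norm h)"
      by (auto simp: eventually_at intro!: exI[of _ 1])
    have "((\<lambda>h :: 'b. norm h * exp (norm h)) \<longlongrightarrow> norm (0 :: 'b) * exp (norm (0 :: 'b))) (at 0)"
      by (intro tendsto_intros)
    then show "((\<lambda>h :: 'b. norm h * exp (norm h)) \<longlongrightarrow> 0) (at 0)" by simp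
  qed
qed


section \<open>Linear endomorphisms as a Banach algebra\<close>

text \<open>The type \<open>'a \<Rightarrow>\<^sub>L 'a\<close> carries no multiplication, hence no power series; this copy of it does.\<close>

typedef (overloaded) 'a endo = "UNIV :: ('a::euclidean_space \<Rightarrow>\<^sub>L 'a) set"
  morphisms blinfun_of_endo endo_of_blinfun ..

setup_lifting type_definition_endo

instantiation endo :: (euclidean_space) real_normed_vector
begin
lift_definition norm_endo :: "'a endo \<Rightarrow> real" is norm .
lift_definition minus_endo :: "'a endo \<Rightarrow> 'a endo \<Rightarrow> 'a endo" is "(-)" .
lift_definition plus_endo :: "'a endo \<Rightarrow> 'a endo \<Rightarrow> 'a endo" is "(+)" .
lift_definition uminus_endo :: "'a endo \<Rightarrow> 'a endo" is uminus .
lift_definition zero_endo :: "'a endo" is 0 .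
lift_definition scaleR_endo :: "real \<Rightarrow> 'a endo \<Rightarrow> 'a endo" is scaleR .
definition dist_endo :: "'a endo \<Rightarrow> 'a endo \<Rightarrow> real" where "dist_endo a b = norm (a - b)"
definition sgn_endo :: "'a endo \<Rightarrow> 'a endo" where "sgn_endo a = scaleR (inverse (norm a)) a"
definition uniformity_endo :: "('a endo \<times> 'a endo) filter" where
  "uniformity_endo = (INF e\<in>{0<..}. principal {(x, y). dist x y < e})"
definition open_endo :: "'a endo set \<Rightarrow> bool" where
  "open_endo S = (\<forall>x\<in>S. \<forall>\<^sub>F (x', y) in uniformity. x' = x \<longrightarrow> y \<in> S)"
instance
  by standard (simp add: dist_endo_def sgn_endo_def uniformity_endo_def open_endo_def |
    (transfer, simp add: algebra_simps norm_triangle_ineq))+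
end

instantiation endo :: (euclidean_space) real_normed_algebra_1
begin
lift_definition times_endo :: "'a endo \<Rightarrow> 'a endo \<Rightarrow> 'a endo" is "(o\<^sub>L)" .
lift_definition one_endo :: "'a endo" is id_blinfun .
instance
proof
  show "(0 :: 'a endo) \<noteq> 1"
  proof
    assume "(0 :: 'a endo) = 1"
    then have "(0 :: 'a \<Rightarrow>\<^sub>L 'a) = id_blinfun" by transfer
    then have "norm (id_blinfun :: 'a \<Rightarrow>\<^sub>L 'a) = 0" by (metis norm_zero)
    then show False by simp
  qed
qed (transfer, auto intro!: blinfun_eqI simp: blinfun.bilinear_simps norm_blinfun_compose)+
end

lemma blinfun_of_endo_isometry: "dist (blinfun_of_endo a) (blinfun_of_endo b) = dist a b"
  unfolding dist_norm by transfer simp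

instance endo :: (euclidean_space) banach
proof
  fix X :: "nat \<Rightarrow> 'a endo" assume "Cauchy X"
  then have "Cauchy (\<lambda>n. blinfun_of_endo (X n))"
    by (simp add: Cauchy_def blinfun_of_endo_isometry)
  then obtain l where "(\<lambda>n. blinfun_of_endo (X n)) \<longlonglongrightarrow> l"
    using Cauchy_convergent convergent_def by blast
  then have "(\<lambda>n. blinfun_of_endo (X n)) \<longlonglongrightarrow> blinfun_of_endo (endo_of_blinfun l)"
    by (simp add: endo_of_blinfun_inverse)
  then have "X \<longlonglongrightarrow> endo_of_blinfun l"
    by (simp add: tendsto_iff blinfun_of_endo_isometry)
  then show "convergent X" by (rule convergentI)
qed

instance endo :: (euclidean_space) heine_borel
proof
  fix X :: "nat \<Rightarrow> 'a endo" assume "bounded (range X)"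
  then obtain B where "\<And>n. norm (X n) \<le> B" by (auto simp: bounded_iff)
  moreover have "norm (blinfun_of_endo (X n)) = norm (X n)" for n by transfer simp
  ultimately have "bounded (range (\<lambda>n. blinfun_of_endo (X n)))"
    by (auto simp: bounded_iff intro!: exI[of _ B])
  then obtain l r where r: "strict_mono r" "((\<lambda>n. blinfun_of_endo (X n)) \<circ> r) \<longlonglongrightarrow> l"
    using bounded_imp_convergent_subsequence by blast
  from r(2) have "(X \<circ> r) \<longlonglongrightarrow> endo_of_blinfun l"
    by (simp add: tendsto_iff blinfun_of_endo_isometry[symmetric] endo_of_blinfun_inverse)
  with r(1) show "\<exists>l r. strict_mono r \<and> (X \<circ> r) \<longlonglongrightarrow> l" by blast
qed

lift_definition endo_apply :: "'a::euclidean_space endo \<Rightarrow> 'a \<Rightarrow> 'a" (infixr "\<star>" 75) is blinfun_apply .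

lemma bounded_bilinear_endo_apply: "bounded_bilinear endo_apply"
proof
  show "\<exists>K. \<forall>(a :: 'a endo) b. norm (a \<star> b) \<le> norm a * norm b * K"
    by (rule exI[of _ 1]) (transfer, simp add: norm_blinfun)
qed (transfer, simp add: blinfun.bilinear_simps)+

interpretation endo: bounded_bilinear endo_apply
  by (rule bounded_bilinear_endo_apply)

lemmas endo_tendsto = endo.tendsto
lemmas endo_simps = endo.add_left endo.diff_left endo.minus_left endo.scaleR_left endo.zero_left
  endo.add_right endo.diff_right endo.minus_right endo.scaleR_right endo.zero_right

lemma endo_one [simp]: "1 \<star> x = x" by transfer simp
lemma endo_mult: "(a * b) \<star> x = a \<star> b \<star> x" by transfer simp
lemma norm_endo_apply_le: "norm (a \<star> x) \<le> norm a * norm x" by transfer (rule norm_blinfun)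
lemma endo_norm_bound: "0 \<le> b \<Longrightarrow> (\<And>x. norm (a \<star> x) \<le> b * norm x) \<Longrightarrow> norm a \<le> b"
  by transfer (rule norm_blinfun_bound)

text \<open>Every term of the exponential series except the zeroth kills \<open>x\<close>.\<close>

lemma exp_fixes_kernel:
  fixes A :: "'a::euclidean_space endo"
  assumes "A \<star> x = 0"
  shows "exp A \<star> x = x"
proof -
  have "(\<lambda>n. (A ^ n /\<^sub>R fact n) \<star> x) sums (exp A \<star> x)"
    by (rule bounded_linear.sums[OF endo.bounded_linear_left exp_converges])
  moreover have "(A ^ n /\<^sub>R fact n) \<star> x = (if n = 0 then x else 0)" for n
    by (cases n) (simp_all add: endo_simps endo_mult assms power_Suc2 del: power_Suc)
  ultimately have "(\<lambda>n. if n = 0 then x else 0) sums (exp A \<star> x)" by simp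
  then show ?thesis using sums_single[of 0 "\<lambda>_. x"] sums_unique2 by fastforce
qed


section \<open>Compact groups of isometries and their Lie algebras\<close>

text \<open>Later instantiated with the image of \<open>G\<close> under the representation. As its
  elements are endomorphisms, limits, difference quotients and exponentials all live in one Banach
  algebra.\<close>

locale compact_isometry_group =
  fixes K :: "'a::euclidean_space endo set"
  assumes compact: "compact K"
    and one_mem: "1 \<in> K"
    and mult_mem: "a \<in> K \<Longrightarrow> b \<in> K \<Longrightarrow> a * b \<in> K"
    and inverse_mem: "a \<in> K \<Longrightarrow> \<exists>b\<in>K. a * b = 1 \<and> b * a = 1"
    and norm_apply: "a \<in> K \<Longrightarrow> norm (a \<star> x) = norm x"
begin

lemma inner_apply: "a \<in> K \<Longrightarrow> (a \<star> x) \<bullet> (a \<star> y) = x \<bullet> y"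
  using norm_apply[of a x] norm_apply[of a y] norm_apply[of a "x + y"]
  by (simp add: dot_norm endo_simps)

lemma obtain_inverse:
  assumes "a \<in> K"
  obtains b where "b \<in> K" "a * b = 1" "b * a = 1" "\<And>x. a \<star> b \<star> x = x" "\<And>x. b \<star> a \<star> x = x"
    "\<And>x y. (a \<star> x) \<bullet> y = x \<bullet> (b \<star> y)"
proof -
  obtain b where b: "b \<in> K" "a * b = 1" "b * a = 1" using inverse_mem[OF assms] by blast
  have ab: "a \<star> b \<star> x = x" "b \<star> a \<star> x = x" for x
    using b by (simp_all flip: endo_mult)
  moreover have "(a \<star> x) \<bullet> y = x \<bullet> (b \<star> y)" for x y
    using inner_apply[OF assms, of x "b \<star> y"] by (simp add: ab)
  ultimately show thesis using b that by blast
qed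

lemma norm_le_one: "a \<in> K \<Longrightarrow> norm a \<le> 1"
  by (rule endo_norm_bound) (simp_all add: norm_apply)

lemma power_mem: "a \<in> K \<Longrightarrow> a ^ n \<in> K"
  by (induction n) (simp_all add: one_mem mult_mem)

lemma limit_mem: "(\<And>n. m n \<in> K) \<Longrightarrow> m \<longlonglongrightarrow> a \<Longrightarrow> a \<in> K"
  using compact_imp_closed[OF compact] closed_sequentially by blast

lemma convergent_subsequence:
  assumes "\<And>n::nat. m n \<in> K"
  obtains r l where "strict_mono (r :: nat \<Rightarrow> nat)" "l \<in> K" "(\<lambda>n. m (r n)) \<longlonglongrightarrow> l"
  using compact[unfolded compact_def] assms unfolding comp_def by metis

text \<open>The Lie algebra of \<open>K\<close>, described by the one-parameter subgroups of
  \<open>K\<close>.\<close>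

definition lie :: "'a endo set" where
  "lie = {A. \<forall>t. exp (t *\<^sub>R A) \<in> K}"

lemma exp_mem: "A \<in> lie \<Longrightarrow> exp (t *\<^sub>R A) \<in> K"
  by (simp add: lie_def)

text \<open>The core of the closed subgroup theorem: the powers
  \<open>m n ^ nat \<lfloor>t / s n\<rfloor>\<close> stay in \<open>K\<close> and converge to
  \<open>exp (t *\<^sub>R A)\<close>, which therefore lies in the closed set \<open>K\<close>.
  Negative \<open>t\<close> follow by inversion.\<close>

lemma lie_limit:
  assumes m: "\<And>n. m n \<in> K" and s: "\<And>n. 0 < s n" "s \<longlonglongrightarrow> 0"
    and lim: "(\<lambda>n. (m n - 1) /\<^sub>R s n) \<longlonglongrightarrow> A"
  shows "A \<in> lie"
proof -
  have pos: "exp (t *\<^sub>R A) \<in> K" if "0 \<le> t" for t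
    using power_tendsto_exp[OF norm_le_one[OF m] s lim that]
    by (rule limit_mem[rotated]) (intro power_mem m)
  have "exp (t *\<^sub>R A) \<in> K" for t
  proof (cases "0 \<le> t")
    case False
    then obtain b where b: "b \<in> K" "exp ((- t) *\<^sub>R A) * b = 1"
      using inverse_mem[OF pos[of "- t"]] by auto
    then have "exp (- ((- t) *\<^sub>R A)) = b" by (intro exp_minus_unique_inverse)
    then show ?thesis using b by simp
  qed (rule pos)
  then show ?thesis by (simp add: lie_def)
qed

lemma lie_scaleR: "A \<in> lie \<Longrightarrow> c *\<^sub>R A \<in> lie"
  by (simp add: lie_def)

text \<open>The product of the two one-parameter subgroups has derivative \<open>A + B\<close> at
  zero, so \<open>lie_limit\<close> applies.\<close>

lemma lie_add:
  assumes "A \<in> lie" "B \<in> lie"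
  shows "A + B \<in> lie"
proof (rule lie_limit)
  define s where "s = (\<lambda>n. inverse (real (Suc n)))"
  show s: "0 < s n" for n by (simp add: s_def)
  show s0: "s \<longlonglongrightarrow> 0" unfolding s_def by (rule LIMSEQ_inverse_real_of_nat)
  have q: "(\<lambda>n. (exp (s n *\<^sub>R C) - 1) /\<^sub>R s n) \<longlonglongrightarrow> C" for C :: "'a endo"
    using s by (intro exp_scaleR_difference_quotient s0) (metis less_irrefl)
  have e: "(\<lambda>n. exp (s n *\<^sub>R B)) \<longlonglongrightarrow> 1"
    using isCont_tendsto_compose[OF continuous_at_exp_scaleR s0, of B] by simp
  show "exp (s n *\<^sub>R A) * exp (s n *\<^sub>R B) \<in> K" for n
    by (intro mult_mem exp_mem assms)
  have "(\<lambda>n. ((exp (s n *\<^sub>R A) - 1) /\<^sub>R s n) * exp (s n *\<^sub>R B) + (exp (s n *\<^sub>R B) - 1) /\<^sub>R s n)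
      \<longlonglongrightarrow> A * 1 + B"
    by (intro tendsto_intros q e)
  then show "(\<lambda>n. (exp (s n *\<^sub>R A) * exp (s n *\<^sub>R B) - 1) /\<^sub>R s n) \<longlonglongrightarrow> A + B"
    by (simp add: algebra_simps)
qed

lemma subspace_lie: "subspace lie"
proof (rule subspaceI)
  show "0 \<in> lie" by (simp add: lie_def one_mem)
qed (simp_all add: lie_add lie_scaleR)

lemma lie_conjugate:
  assumes "A \<in> lie" and c: "c \<in> K" "d \<in> K" "c * d = 1"
  shows "c * A * d \<in> lie"
proof (rule lie_limit)
  define s where "s = (\<lambda>n. inverse (real (Suc n)))"
  show s: "0 < s n" for n by (simp add: s_def)
  show s0: "s \<longlonglongrightarrow> 0" unfolding s_def by (rule LIMSEQ_inverse_real_of_nat)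
  have q: "(\<lambda>n. (exp (s n *\<^sub>R A) - 1) /\<^sub>R s n) \<longlonglongrightarrow> A"
    using s by (intro exp_scaleR_difference_quotient s0) (metis less_irrefl)
  show "c * exp (s n *\<^sub>R A) * d \<in> K" for n
    by (intro mult_mem exp_mem assms)
  have "(\<lambda>n. c * ((exp (s n *\<^sub>R A) - 1) /\<^sub>R s n) * d) \<longlonglongrightarrow> c * A * d"
    by (intro tendsto_intros q)
  then show "(\<lambda>n. (c * exp (s n *\<^sub>R A) * d - 1) /\<^sub>R s n) \<longlonglongrightarrow> c * A * d"
    by (simp add: algebra_simps c)
qed

text \<open>The first-order condition at \<open>t = 0\<close> for
  \<open>(exp (t *\<^sub>R A) \<star> x) \<bullet> y\<close>. Since norms are constant on orbits,
  the hypothesis says that \<open>x\<close> is a point of its orbit nearest to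
  \<open>y\<close>.\<close>

lemma lie_orthogonal_of_max:
  assumes "A \<in> lie" and max: "\<And>a. a \<in> K \<Longrightarrow> (a \<star> x) \<bullet> y \<le> x \<bullet> y"
  shows "(A \<star> x) \<bullet> y = 0"
proof -
  have "((\<lambda>t. exp (t *\<^sub>R A)) has_derivative (\<lambda>h. h *\<^sub>R A)) (at 0)"
    using exp_scaleR_has_vector_derivative_right[of A 0 UNIV] by (simp add: has_vector_derivative_def)
  then have "((\<lambda>t. (exp (t *\<^sub>R A) \<star> x) \<bullet> y) has_derivative (\<lambda>h. ((h *\<^sub>R A) \<star> x) \<bullet> y)) (at 0)"
    by (intro has_derivative_inner_left bounded_linear.has_derivative[OF endo.bounded_linear_left])
  then have "((\<lambda>t. (exp (t *\<^sub>R A) \<star> x) \<bullet> y) has_real_derivative (A \<star> x) \<bullet> y) (at 0)"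
    by (simp add: has_field_derivative_def endo_simps mult_commute_abs)
  then show ?thesis
    by (rule DERIV_local_max[of _ _ _ 1]) (auto intro!: max exp_mem assms)
qed

lemma lie_skew: "A \<in> lie \<Longrightarrow> (A \<star> x) \<bullet> x = 0"
proof (rule lie_orthogonal_of_max)
  fix a assume "a \<in> K"
  then show "(a \<star> x) \<bullet> x \<le> x \<bullet> x"
    using norm_cauchy_schwarz[of "a \<star> x" x] by (simp add: norm_apply power2_eq_square flip: power2_norm_eq_inner)
qed

lemma lie_skew': "A \<in> lie \<Longrightarrow> (A \<star> x) \<bullet> y = - ((A \<star> y) \<bullet> x)"
  using lie_skew[of A "x + y"] lie_skew[of A x] lie_skew[of A y]
  by (simp add: endo_simps inner_simps inner_commute)

section \<open>Orbits near a point: small representatives, velocities and slices\<close>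

text \<open>Otherwise choose \<open>h\<close> of minimal distance to \<open>1\<close> in its coset: the limit direction \<open>B\<close> of
  \<open>h - 1\<close> kills \<open>b\<close>, and \<open>h * exp (- \<delta> B)\<close> is closer to \<open>1\<close>.\<close>

lemma small_representative:
  "\<exists>C>0. \<forall>g\<in>K. \<exists>h\<in>K. h \<star> b = g \<star> b \<and> norm (h - 1) \<le> C * norm (g \<star> b - b)"
proof (rule ccontr)
  assume contr: "\<not> ?thesis"
  have "\<exists>h. h \<in> K \<and> (\<forall>k\<in>K. k \<star> b = h \<star> b \<longrightarrow> norm (h - 1) \<le> norm (k - 1))
      \<and> Suc n * norm (h \<star> b - b) < norm (h - 1)" for n
  proof -
    have "0 < real (Suc n)" by simp
    then obtain g where g: "g \<in> K"
      "\<And>h. h \<in> K \<Longrightarrow> h \<star> b = g \<star> b \<Longrightarrow> real (Suc n) * norm (g \<star> b - b) < norm (h - 1)"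
      using contr by (meson not_le)
    let ?F = "K \<inter> {h. h \<star> b = g \<star> b}"
    have "compact ?F"
      by (intro compact_Int_closed compact closed_Collect_eq continuous_intros
          bounded_linear.continuous_on[OF endo.bounded_linear_left])
    moreover have "?F \<noteq> {}" using g by auto
    moreover have "continuous_on ?F (\<lambda>h. norm (h - 1))" by (intro continuous_intros)
    ultimately obtain h where "h \<in> ?F" "\<And>k. k \<in> ?F \<Longrightarrow> norm (h - 1) \<le> norm (k - 1)"
      using continuous_attains_inf[of ?F "\<lambda>h. norm (h - 1)"] by metis
    then show ?thesis using g by (intro exI[of _ h]) auto
  qed
  then obtain h where hK: "\<And>n. h n \<in> K"
    and hmin: "\<And>n k. k \<in> K \<Longrightarrow> k \<star> b = h n \<star> b \<Longrightarrow> norm (h n - 1) \<le> norm (k - 1)"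
    and hlt: "\<And>n. real (Suc n) * norm (h n \<star> b - b) < norm (h n - 1)"
    by metis
  have hb: "(\<lambda>n. h n \<star> b - b) \<longlonglongrightarrow> 0"
  proof (rule Lim_null_comparison)
    have "norm (h n \<star> b - b) \<le> 2 * inverse (real (Suc n))" for n
    proof -
      have "norm (h n - 1) \<le> 2"
        using norm_triangle_ineq4[of "h n" 1] norm_le_one[OF hK[of n]] by simp
      then show ?thesis using hlt[of n] by (simp add: field_simps)
    qed
    then show "\<forall>\<^sub>F n in sequentially. norm (h n \<star> b - b) \<le> 2 * inverse (real (Suc n))" by simp
    show "(\<lambda>n. 2 * inverse (real (Suc n))) \<longlonglongrightarrow> 0"
      by (rule tendsto_mult_right_zero[OF LIMSEQ_inverse_real_of_nat])
  qed
  obtain r l where r: "strict_mono r" and l: "l \<in> K" and hl: "(\<lambda>n. h (r n)) \<longlonglongrightarrow> l"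
    using convergent_subsequence[of h, OF hK] by blast
  have lb: "l \<star> b = b"
  proof -
    have "(\<lambda>n. h (r n) \<star> b - b) \<longlonglongrightarrow> l \<star> b - b"
      by (intro tendsto_intros endo_tendsto hl)
    moreover have "(\<lambda>n. h (r n) \<star> b - b) \<longlonglongrightarrow> 0"
      using LIMSEQ_subseq_LIMSEQ[OF hb r] by (simp add: comp_def)
    ultimately have "l \<star> b - b = 0" by (rule LIMSEQ_unique)
    then show ?thesis by simp
  qed
  obtain l' where l': "l' \<in> K" "l * l' = 1" "\<And>x. l' \<star> l \<star> x = x"
    using obtain_inverse[OF l] by metis
  define \<delta> where "\<delta> = (\<lambda>n. norm (h (r n) - 1))"
  have \<delta>pos: "0 < \<delta> n" for n
    unfolding \<delta>_def by (rule le_less_trans[OF _ hlt]) simp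
  \<comment> \<open>The limit \<open>l\<close> fixes \<open>b\<close>, so
    \<open>h (r n) * l'\<close> acts on \<open>b\<close> as \<open>h (r n)\<close> does. By
    minimality, its distance to \<open>1\<close>, which tends to zero, bounds
    \<open>\<delta> n\<close>.\<close>
  have \<delta>0: "\<delta> \<longlonglongrightarrow> 0"
  proof (rule Lim_null_comparison)
    have "l' \<star> b = b" using l'(3)[of b] lb by simp
    then have "\<delta> n \<le> norm (h (r n) * l' - 1)" for n
      unfolding \<delta>_def by (intro hmin mult_mem hK l') (simp add: endo_mult)
    then show "\<forall>\<^sub>F n in sequentially. norm (\<delta> n) \<le> norm (h (r n) * l' - 1)"
      using \<delta>pos by (simp add: less_imp_le)
    have "(\<lambda>n. norm (h (r n) * l' - 1)) \<longlonglongrightarrow> norm (l * l' - 1)"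
      by (intro tendsto_intros hl)
    then show "(\<lambda>n. norm (h (r n) * l' - 1)) \<longlonglongrightarrow> 0" using l' by simp
  qed
  define u where "u = (\<lambda>n. (h (r n) - 1) /\<^sub>R \<delta> n)"
  have norm_u: "norm (u n) = 1" for n
    using \<delta>pos[of n] unfolding u_def by (simp add: \<delta>_def)
  then have "bounded (range u)" by (auto simp: bounded_iff)
  then obtain B r' where r': "strict_mono r'" and B: "(\<lambda>n. u (r' n)) \<longlonglongrightarrow> B"
    using bounded_imp_convergent_subsequence[of u] by (auto simp: comp_def)
  have \<delta>r: "(\<lambda>n. \<delta> (r' n)) \<longlonglongrightarrow> 0"
    using LIMSEQ_subseq_LIMSEQ[OF \<delta>0 r'] by (simp add: comp_def)
  have Blie: "B \<in> lie"
    using B unfolding u_def by (rule lie_limit[OF hK \<delta>pos \<delta>r])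
  have Bb: "B \<star> b = 0"
  proof (rule LIMSEQ_unique)
    show "(\<lambda>n. u (r' n) \<star> b) \<longlonglongrightarrow> B \<star> b" by (intro endo_tendsto B tendsto_const)
    show "(\<lambda>n. u (r' n) \<star> b) \<longlonglongrightarrow> 0"
    proof (rule Lim_null_comparison)
      have "norm (u (r' n) \<star> b) \<le> inverse (real (Suc n))" for n
      proof -
        have "n \<le> r (r' n)" using seq_suble[OF strict_mono_o[OF r r'], of n] by simp
        then have "real (Suc n) * norm (h (r (r' n)) \<star> b - b) \<le> real (Suc (r (r' n))) * norm (h (r (r' n)) \<star> b - b)"
          by (intro mult_right_mono) auto
        also have "\<dots> \<le> \<delta> (r' n)" unfolding \<delta>_def by (rule less_imp_le[OF hlt])
        finally have "real (Suc n) * norm (h (r (r' n)) \<star> b - b) \<le> \<delta> (r' n)" .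
        moreover have "norm (h (r (r' n)) \<star> b - b) = \<delta> (r' n) * norm (u (r' n) \<star> b)"
          using \<delta>pos[of "r' n"]
          by (simp add: u_def endo.scaleR_left endo.diff_left del: scaleR_diff_right)
        ultimately have "\<delta> (r' n) * (real (Suc n) * norm (u (r' n) \<star> b)) \<le> \<delta> (r' n) * 1"
          by (simp only: mult_ac mult_1_right)
        then have "real (Suc n) * norm (u (r' n) \<star> b) \<le> 1"
          using \<delta>pos[of "r' n"] by (simp only: mult_le_cancel_left_pos)
        then show ?thesis by (simp add: field_simps)
      qed
      then show "\<forall>\<^sub>F n in sequentially. norm (u (r' n) \<star> b) \<le> inverse (real (Suc n))" by simp
    qed (rule LIMSEQ_inverse_real_of_nat)
  qed
  \<comment> \<open>As \<open>B\<close> kills \<open>b\<close>, each \<open>e n\<close> fixes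
    \<open>b\<close>, so by minimality \<open>h (r (r' n)) * e n\<close> is no closer to
    \<open>1\<close> than \<open>h (r (r' n))\<close>. But this product minus \<open>1\<close> is
    \<open>\<delta> (r' n)\<close> times an expression that tends to \<open>B - B\<close>.\<close>
  define e where "e = (\<lambda>n. exp ((- \<delta> (r' n)) *\<^sub>R B))"
  have "(\<lambda>n. u (r' n) * e n - (e n - 1) /\<^sub>R (- \<delta> (r' n))) \<longlonglongrightarrow> B * 1 - B"
  proof (intro tendsto_intros B)
    have "(\<lambda>n. - \<delta> (r' n)) \<longlonglongrightarrow> 0" using tendsto_minus[OF \<delta>r] by simp
    then show "e \<longlonglongrightarrow> 1" "(\<lambda>n. (e n - 1) /\<^sub>R (- \<delta> (r' n))) \<longlonglongrightarrow> B"
      unfolding e_def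
      using isCont_tendsto_compose[OF continuous_at_exp_scaleR, of "\<lambda>n. - \<delta> (r' n)" 0 sequentially B]
        exp_scaleR_difference_quotient[of "\<lambda>n. - \<delta> (r' n)" B] \<delta>pos
      by (simp_all add: less_imp_neq[symmetric])
  qed
  then have "(\<lambda>n. norm (u (r' n) * e n - (e n - 1) /\<^sub>R (- \<delta> (r' n)))) \<longlonglongrightarrow> 0"
    by (intro tendsto_norm_zero) simp
  moreover have "1 \<le> norm (u (r' n) * e n - (e n - 1) /\<^sub>R (- \<delta> (r' n)))" for n
  proof -
    have "e n \<star> b = b"
      unfolding e_def by (rule exp_fixes_kernel) (simp add: endo_simps Bb)
    then have "\<delta> (r' n) \<le> norm (h (r (r' n)) * e n - 1)"
      unfolding \<delta>_def by (intro hmin mult_mem hK) (simp_all add: endo_mult e_def exp_mem Blie del: scaleR_minus_left)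
    moreover have "h (r (r' n)) * e n - 1 = \<delta> (r' n) *\<^sub>R (u (r' n) * e n - (e n - 1) /\<^sub>R (- \<delta> (r' n)))"
      using \<delta>pos[of "r' n"] by (simp add: u_def algebra_simps)
    ultimately have "\<delta> (r' n) * 1 \<le> \<delta> (r' n) * norm (u (r' n) * e n - (e n - 1) /\<^sub>R (- \<delta> (r' n)))"
      using \<delta>pos[of "r' n"] by simp
    then show ?thesis using \<delta>pos[of "r' n"] by (simp only: mult_le_cancel_left_pos)
  qed
  ultimately have "(1::real) \<le> 0" by (intro LIMSEQ_le_const) auto
  then show False by simp
qed

text \<open>This describes the tangent vectors of an orbit by the Lie algebra. By
  \<open>small_representative\<close>, elements carrying \<open>\<gamma> 0\<close> to
  \<open>\<gamma> (s n)\<close> can be chosen at distance \<open>O(s n)\<close> from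
  \<open>1\<close>; a subsequence of their difference quotients converges, and
  \<open>lie_limit\<close> puts the limit into \<open>lie\<close>.\<close>

lemma orbit_velocity:
  assumes der: "(\<gamma> has_vector_derivative v) (at 0)" and "0 < e"
    and orb: "\<And>t. \<bar>t\<bar> < e \<Longrightarrow> \<exists>g\<in>K. \<gamma> t = g \<star> \<gamma> 0"
  shows "\<exists>A\<in>lie. v = A \<star> \<gamma> 0"
proof -
  define s where "s = (\<lambda>n. e / 2 * inverse (real (Suc n)))"
  have s: "0 < s n" "s n < e" for n
  proof -
    show "0 < s n" using \<open>0 < e\<close> by (simp add: s_def)
    have "e / 2 * inverse (real (Suc n)) \<le> e / 2 * 1"
      using \<open>0 < e\<close> by (intro mult_left_mono) (auto simp: field_simps)
    then show "s n < e" using \<open>0 < e\<close> by (simp add: s_def)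
  qed
  have s0: "s \<longlonglongrightarrow> 0"
    unfolding s_def by (rule tendsto_mult_right_zero[OF LIMSEQ_inverse_real_of_nat])
  obtain C where C: "0 < C" "\<And>g. g \<in> K \<Longrightarrow> \<exists>h\<in>K. h \<star> \<gamma> 0 = g \<star> \<gamma> 0 \<and> norm (h - 1) \<le> C * norm (g \<star> \<gamma> 0 - \<gamma> 0)"
    using small_representative[of "\<gamma> 0"] by blast
  have "\<exists>h\<in>K. h \<star> \<gamma> 0 = \<gamma> (s n) \<and> norm (h - 1) \<le> C * norm (\<gamma> (s n) - \<gamma> 0)" for n
  proof -
    have "\<bar>s n\<bar> < e" using s[of n] by simp
    from orb[OF this] show ?thesis using C(2) by metis
  qed
  then obtain h where h: "\<And>n. h n \<in> K" "\<And>n. h n \<star> \<gamma> 0 = \<gamma> (s n)"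
    "\<And>n. norm (h n - 1) \<le> C * norm (\<gamma> (s n) - \<gamma> 0)" by metis
  have q: "(\<lambda>n. (\<gamma> (s n) - \<gamma> 0) /\<^sub>R s n) \<longlonglongrightarrow> v"
    using has_vector_derivative_imp_difference_quotient[OF der s0] s by (simp add: less_imp_neq[symmetric])
  then obtain D where D: "\<And>n. norm ((\<gamma> (s n) - \<gamma> 0) /\<^sub>R s n) \<le> D"
    using convergent_imp_bounded[OF q] unfolding bounded_iff by auto
  define u where "u = (\<lambda>n. (h n - 1) /\<^sub>R s n)"
  have "norm (u n) \<le> C * D" for n
  proof -
    have "norm (u n) \<le> C * norm ((\<gamma> (s n) - \<gamma> 0) /\<^sub>R s n)"
      using h(3)[of n] s[of n] by (simp add: u_def divide_simps del: scaleR_diff_right)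
    also have "\<dots> \<le> C * D" using C D by simp
    finally show ?thesis .
  qed
  then have "bounded (range u)" by (auto simp: bounded_iff)
  then obtain A r where r: "strict_mono r" and A: "(\<lambda>n. u (r n)) \<longlonglongrightarrow> A"
    using bounded_imp_convergent_subsequence[of u] by (auto simp: comp_def)
  have "A \<in> lie"
    using A LIMSEQ_subseq_LIMSEQ[OF s0 r] unfolding u_def comp_def
    by (intro lie_limit[of "\<lambda>n. h (r n)" "\<lambda>n. s (r n)"] h s)
  moreover have "v = A \<star> \<gamma> 0"
  proof (rule LIMSEQ_unique)
    show "(\<lambda>n. (\<gamma> (s (r n)) - \<gamma> 0) /\<^sub>R s (r n)) \<longlonglongrightarrow> v"
      using LIMSEQ_subseq_LIMSEQ[OF q r] by (simp add: comp_def)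
    have "(\<lambda>n. u (r n) \<star> \<gamma> 0) \<longlonglongrightarrow> A \<star> \<gamma> 0" by (intro endo_tendsto A tendsto_const)
    then show "(\<lambda>n. (\<gamma> (s (r n)) - \<gamma> 0) /\<^sub>R s (r n)) \<longlonglongrightarrow> A \<star> \<gamma> 0"
      by (simp add: u_def endo_simps h)
  qed
  ultimately show ?thesis by blast
qed

definition stab :: "'a \<Rightarrow> 'a endo set" where
  "stab x = {a \<in> K. a \<star> x = x}"

text \<open>Suppose that \<open>g n\<close> fixes \<open>b + s n *\<^sub>R w\<close> but moves
  \<open>b\<close>. Factor \<open>g n\<close> into \<open>h n\<close> and an element of
  \<open>stab b\<close>, where \<open>h n - 1\<close> is bounded by the displacement of
  \<open>b\<close>. Let \<open>A\<close> be a limit direction of \<open>h n - 1\<close>. Since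
  \<open>w\<close> is normal, pairing the displacement with \<open>A \<star> b\<close> leaves only
  higher order terms, so \<open>A \<star> b = 0\<close>, which contradicts the bound.\<close>

lemma stab_normal_line:
  assumes w: "\<And>A. A \<in> lie \<Longrightarrow> (A \<star> b) \<bullet> w = 0"
  shows "\<exists>e>0. \<forall>s. \<bar>s\<bar> < e \<longrightarrow> stab (b + s *\<^sub>R w) \<subseteq> stab b"
proof (rule ccontr)
  assume contr: "\<not> ?thesis"
  have "\<exists>s g. \<bar>s\<bar> < inverse (real (Suc n)) \<and> g \<in> K \<and> g \<star> (b + s *\<^sub>R w) = b + s *\<^sub>R w \<and> g \<star> b \<noteq> b" for n
  proof -
    have "0 < inverse (real (Suc n))" by simp
    then obtain s where "\<bar>s\<bar> < inverse (real (Suc n))" "\<not> stab (b + s *\<^sub>R w) \<subseteq> stab b"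
      using contr by blast
    then show ?thesis by (auto simp: stab_def)
  qed
  then obtain s g where s: "\<And>n. \<bar>s n\<bar> < inverse (real (Suc n))" and g: "\<And>n. g n \<in> K"
    and gfix: "\<And>n. g n \<star> (b + s n *\<^sub>R w) = b + s n *\<^sub>R w" and gb: "\<And>n. g n \<star> b \<noteq> b"
    by metis
  have s0: "s \<longlonglongrightarrow> 0"
    by (rule Lim_null_comparison[OF always_eventually LIMSEQ_inverse_real_of_nat])
      (simp only: real_norm_def less_imp_le[OF s] simp_thms)
  obtain C where C: "0 < C" "\<And>g. g \<in> K \<Longrightarrow> \<exists>h\<in>K. h \<star> b = g \<star> b \<and> norm (h - 1) \<le> C * norm (g \<star> b - b)"
    using small_representative[of b] by blast
  have "\<exists>h. h \<in> K \<and> h \<star> b = g n \<star> b \<and> norm (h - 1) \<le> C * norm (h \<star> b - b)" for n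
    using C(2)[OF g[of n]] by auto
  then obtain h where h: "\<And>n. h n \<in> K" "\<And>n. h n \<star> b = g n \<star> b"
    "\<And>n. norm (h n - 1) \<le> C * norm (h n \<star> b - b)" by metis
  \<comment> \<open>Here \<open>e\<close> is the inverse of \<open>h n\<close> times
    \<open>g n\<close>, and \<open>e'\<close> is the inverse, hence the adjoint, of
    \<open>e\<close>.\<close>
  have "\<exists>e e'. e \<in> K \<and> e' \<in> K \<and> e' * e = 1 \<and> e \<star> b = b \<and> e' \<star> b = b \<and> h n \<star> e \<star> w = g n \<star> w
     \<and> (\<forall>x y. (e' \<star> x) \<bullet> y = x \<bullet> (e \<star> y))" for n
  proof -
    obtain h' where h': "h' \<in> K" "\<And>x. h n \<star> h' \<star> x = x" "\<And>x. h' \<star> h n \<star> x = x"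
      using obtain_inverse[OF h(1)] by metis
    let ?e = "h' * g n"
    have e: "?e \<in> K" by (intro mult_mem h' g)
    have eb: "?e \<star> b = b" using h'(3)[of b] by (simp add: endo_mult h(2))
    obtain e' where e': "e' \<in> K" "e' * ?e = 1" "\<And>x. ?e \<star> e' \<star> x = x" "\<And>x. e' \<star> ?e \<star> x = x"
      "\<And>x y. (?e \<star> x) \<bullet> y = x \<bullet> (e' \<star> y)"
      using obtain_inverse[OF e] by metis
    show ?thesis
    proof (rule exI[of _ ?e], rule exI[of _ e'], intro conjI allI)
      show "e' \<star> b = b" using e'(4)[of b] eb by simp
      show "h n \<star> ?e \<star> w = g n \<star> w" by (simp add: endo_mult h'(2))
      show "(e' \<star> x) \<bullet> y = x \<bullet> (?e \<star> y)" for x y using e'(5)[of y x] by (simp add: inner_commute)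
    qed (use e eb e' in auto)
  qed
  then obtain e e' where e: "\<And>n. e n \<in> K" "\<And>n. e' n \<in> K" "\<And>n. e' n * e n = 1" "\<And>n. e n \<star> b = b"
    "\<And>n. e' n \<star> b = b" "\<And>n. h n \<star> e n \<star> w = g n \<star> w" "\<And>n x y. (e' n \<star> x) \<bullet> y = x \<bullet> (e n \<star> y)"
    by metis
  have eq: "h n \<star> b - b = - s n *\<^sub>R (h n \<star> e n \<star> w - w)" for n
    using gfix[of n] unfolding h(2) e(6) by (simp add: endo_simps algebra_simps)
  \<comment> \<open>The isometry \<open>e n\<close> fixes \<open>b\<close> and conjugation with it
    preserves \<open>lie\<close>, so \<open>e n \<star> w\<close> is again normal to the orbit at
    \<open>b\<close>.\<close>
  have eA: "(A \<star> b) \<bullet> (e n \<star> w) = 0" if "A \<in> lie" for A n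
  proof -
    have "(A \<star> b) \<bullet> (e n \<star> w) = ((e' n * A * e n) \<star> b) \<bullet> w"
      by (simp add: endo_mult e(4) e(7))
    then show ?thesis using w[OF lie_conjugate[OF that e(2,1,3)]] by simp
  qed
  define \<delta> where "\<delta> = (\<lambda>n. norm (h n - 1))"
  have \<delta>pos: "0 < \<delta> n" for n
    using gb[of n] h(2)[of n] by (auto simp: \<delta>_def)
  have \<delta>0: "\<delta> \<longlonglongrightarrow> 0"
  proof (rule Lim_null_comparison)
    have "\<delta> n \<le> C * (\<bar>s n\<bar> * (2 * norm w))" for n
    proof -
      have "norm (h n \<star> e n \<star> w - w) \<le> 2 * norm w"
        using norm_triangle_ineq4[of "h n \<star> e n \<star> w" w] by (simp add: norm_apply g e)
      then have "norm (h n \<star> b - b) \<le> \<bar>s n\<bar> * (2 * norm w)"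
        unfolding eq by (simp add: mult_left_mono)
      then show ?thesis unfolding \<delta>_def using h(3)[of n] C(1) by (meson less_imp_le mult_left_mono order.trans)
    qed
    then show "\<forall>\<^sub>F n in sequentially. norm (\<delta> n) \<le> C * (\<bar>s n\<bar> * (2 * norm w))"
      using \<delta>pos by (simp add: less_imp_le)
    show "(\<lambda>n. C * (\<bar>s n\<bar> * (2 * norm w))) \<longlonglongrightarrow> 0"
      by (rule tendsto_mult_right_zero[OF tendsto_mult_left_zero[OF tendsto_rabs_zero[OF s0]]])
  qed
  define u where "u = (\<lambda>n. (h n - 1) /\<^sub>R \<delta> n)"
  have norm_u: "norm (u n) = 1" for n
    using \<delta>pos[of n] unfolding u_def by (simp add: \<delta>_def)
  then have "bounded (range u)" by (auto simp: bounded_iff)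
  then obtain A r where r: "strict_mono r" and A: "(\<lambda>n. u (r n)) \<longlonglongrightarrow> A"
    using bounded_imp_convergent_subsequence[of u] by (auto simp: comp_def)
  have Alie: "A \<in> lie"
    using A LIMSEQ_subseq_LIMSEQ[OF \<delta>0 r] unfolding u_def comp_def
    by (intro lie_limit[of "\<lambda>n. h (r n)" "\<lambda>n. \<delta> (r n)"] h \<delta>pos)
  have ub: "(\<lambda>n. u (r n) \<star> b) \<longlonglongrightarrow> A \<star> b" by (intro endo_tendsto A tendsto_const)
  \<comment> \<open>Both \<open>w\<close> and \<open>e n \<star> w\<close> are orthogonal to
    \<open>A \<star> b\<close>, so on the right of \<open>eq\<close> only
    \<open>(h n - 1) \<star> e n \<star> w\<close> contributes, which carries an additional factor
    \<open>\<delta> n\<close>.\<close>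
  have "(A \<star> b) \<bullet> (u n \<star> b) = - s n * ((A \<star> b) \<bullet> (u n \<star> e n \<star> w))" for n
  proof -
    have "(A \<star> b) \<bullet> (h n \<star> b - b) = - s n * ((A \<star> b) \<bullet> ((h n - 1) \<star> e n \<star> w))"
      unfolding eq by (simp add: endo_simps inner_diff_right w[OF Alie] eA[OF Alie])
    moreover have "h n \<star> b - b = \<delta> n *\<^sub>R (u n \<star> b)" "(h n - 1) \<star> e n \<star> w = \<delta> n *\<^sub>R (u n \<star> e n \<star> w)"
      using \<delta>pos[of n] by (simp_all add: u_def endo_simps)
    ultimately have "\<delta> n * ((A \<star> b) \<bullet> (u n \<star> b)) = \<delta> n * (- s n * ((A \<star> b) \<bullet> (u n \<star> e n \<star> w)))"
      by (simp add: algebra_simps)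
    then show ?thesis using \<delta>pos[of n] by (simp only: mult_cancel_left) auto
  qed
  then have "norm ((A \<star> b) \<bullet> (u n \<star> b)) \<le> \<bar>s n\<bar> * (norm (A \<star> b) * norm w)" for n
  proof -
    have "norm (u n \<star> e n \<star> w) \<le> norm w"
      using norm_endo_apply_le[of "u n" "e n \<star> w"] by (simp add: norm_u norm_apply e)
    then have "\<bar>(A \<star> b) \<bullet> (u n \<star> e n \<star> w)\<bar> \<le> norm (A \<star> b) * norm w"
      by (meson Cauchy_Schwarz_ineq2 mult_left_mono norm_ge_zero order.trans)
    then show ?thesis
      using \<open>(A \<star> b) \<bullet> (u n \<star> b) = - s n * ((A \<star> b) \<bullet> (u n \<star> e n \<star> w))\<close>
      by (simp add: abs_mult mult_left_mono)
  qed
  then have "(\<lambda>n. (A \<star> b) \<bullet> (u n \<star> b)) \<longlonglongrightarrow> 0"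
    by (intro Lim_null_comparison[OF always_eventually tendsto_mult_left_zero[OF tendsto_rabs_zero[OF s0]]] allI)
  from LIMSEQ_subseq_LIMSEQ[OF this r] have "(\<lambda>n. (A \<star> b) \<bullet> (u (r n) \<star> b)) \<longlonglongrightarrow> 0"
    by (simp add: comp_def)
  moreover have "(\<lambda>n. (A \<star> b) \<bullet> (u (r n) \<star> b)) \<longlonglongrightarrow> (A \<star> b) \<bullet> (A \<star> b)"
    by (intro tendsto_intros ub)
  ultimately have "A \<star> b = 0" using LIMSEQ_unique inner_eq_zero_iff by metis
  moreover have "1 / C \<le> norm (u n \<star> b)" for n
  proof -
    have "h n \<star> b - b = \<delta> n *\<^sub>R (u n \<star> b)"
      using \<delta>pos[of n] by (simp add: u_def endo.scaleR_left endo.diff_left del: scaleR_diff_right)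
    moreover have "norm (h n - 1) = \<delta> n" by (simp add: \<delta>_def)
    ultimately have "\<delta> n * 1 \<le> \<delta> n * (C * norm (u n \<star> b))"
      using h(3)[of n] \<delta>pos[of n] by (simp add: mult.left_commute)
    then have "1 \<le> C * norm (u n \<star> b)"
      using \<delta>pos[of n] by (simp only: mult_le_cancel_left_pos)
    then show ?thesis using C(1) by (simp add: divide_le_eq mult.commute)
  qed
  then have "1 / C \<le> norm (A \<star> b)"
    by (intro LIMSEQ_le_const[OF tendsto_norm[OF ub]]) auto
  ultimately show False using C(1) by simp
qed

end


section \<open>Regular points\<close>

context compact_isometry_group
begin

text \<open>The conjugation in the condition on isotropy groups is absorbed into the point:
  \<open>stab (a \<star> q)\<close> is the conjugate of \<open>stab q\<close> by
  \<open>a\<close>.\<close>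

definition regular :: "'a \<Rightarrow> bool" where
  "regular p \<longleftrightarrow> (\<forall>q. \<exists>a\<in>K. stab p \<subseteq> stab (a \<star> q))"

lemma regular_mono: "regular p \<Longrightarrow> stab x \<subseteq> stab p \<Longrightarrow> regular x"
  unfolding regular_def by (meson subset_trans)

lemma regular_apply:
  assumes "regular p" "a \<in> K"
  shows "regular (a \<star> p)"
  unfolding regular_def
proof
  fix q
  obtain c where c: "c \<in> K" "stab p \<subseteq> stab (c \<star> q)" using assms(1) by (auto simp: regular_def)
  obtain b where b: "b \<in> K" "\<And>x. a \<star> b \<star> x = x" "\<And>x. b \<star> a \<star> x = x"
    using obtain_inverse[OF assms(2)] by metis
  have "k \<star> (a * c) \<star> q = (a * c) \<star> q" if "k \<in> K" "k \<star> a \<star> p = a \<star> p" for k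
  proof -
    have "b * k * a \<in> stab p" using that assms(2) b by (simp add: stab_def mult_mem endo_mult)
    then have "b \<star> k \<star> a \<star> c \<star> q = c \<star> q" using c by (auto simp: stab_def endo_mult)
    then show ?thesis using b(2) by (metis endo_mult)
  qed
  then show "\<exists>e\<in>K. stab (a \<star> p) \<subseteq> stab (e \<star> q)"
    using c(1) assms(2) by (intro bexI[of _ "a * c"]) (auto simp: stab_def mult_mem)
qed

lemma obtain_max_inner:
  obtains a where "a \<in> K" "\<And>b. b \<in> K \<Longrightarrow> (b \<star> x) \<bullet> y \<le> (a \<star> x) \<bullet> y"
proof -
  have "continuous_on K (\<lambda>a. (a \<star> x) \<bullet> y)"
    by (intro continuous_intros bounded_linear.continuous_on[OF endo.bounded_linear_left])
  with compact one_mem show thesis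
    using continuous_attains_sup[of K "\<lambda>a. (a \<star> x) \<bullet> y"] that by blast
qed

text \<open>The fixed spaces of isotropy groups replace the descending chain condition for closed
  subgroups: \<open>stab x\<close> is the pointwise stabilizer of \<open>fixed x\<close>.\<close>

lemma regular_exists: "\<exists>p. regular p"
proof -
  define fixed where "fixed = (\<lambda>p. {x. stab p \<subseteq> stab x})"
  have subspace_fixed: "subspace (fixed p)" for p
    by (rule subspaceI) (simp_all add: fixed_def stab_def endo_simps subset_iff)
  obtain p where p: "\<And>x. dim (fixed x) \<le> dim (fixed p)"
  proof -
    have "\<exists>p. \<forall>x. dim (fixed x) \<le> dim (fixed p)"
      using ex_has_greatest_nat[of "\<lambda>_. True" 0 "\<lambda>x. dim (fixed x)" "Suc DIM('a)"]
      by (simp add: less_Suc_eq_le dim_subset_UNIV)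
    then show thesis using that by blast
  qed
  have "\<exists>a\<in>K. stab p \<subseteq> stab (a \<star> q)" for q
  proof -
    obtain a where a: "a \<in> K" "\<And>b. b \<in> K \<Longrightarrow> (b \<star> q) \<bullet> p \<le> (a \<star> q) \<bullet> p"
      using obtain_max_inner by blast
    let ?y = "a \<star> q"
    \<comment> \<open>If \<open>k\<close> fixes \<open>p + ?y\<close>, then
      \<open>k \<star> p\<close> and \<open>p\<close> have the same inner product with
      \<open>p + ?y\<close>. By the choice of \<open>a\<close>, the inner product of
      \<open>k \<star> p\<close> with \<open>?y\<close> is not larger than that of \<open>p\<close>,
      so the one with \<open>p\<close> is not smaller; as the norms agree,
      \<open>k \<star> p = p\<close>.\<close>
    have "stab (p + ?y) \<subseteq> stab p"
    proof
      fix k assume "k \<in> stab (p + ?y)"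
      then have k: "k \<in> K" "k \<star> (p + ?y) = p + ?y" by (auto simp: stab_def)
      obtain k' where k': "k' \<in> K" "\<And>x y. (k \<star> x) \<bullet> y = x \<bullet> (k' \<star> y)"
        using obtain_inverse[OF k(1)] by metis
      have "(k \<star> p) \<bullet> ?y \<le> p \<bullet> ?y"
        using a(2)[OF mult_mem[OF k'(1) a(1)]]
        by (simp only: k'(2) endo_mult inner_commute[of p])
      moreover have "(k \<star> p) \<bullet> (p + ?y) = p \<bullet> (p + ?y)"
        using inner_apply[OF k(1), of p "p + ?y"] k(2) by simp
      ultimately have "p \<bullet> p \<le> (k \<star> p) \<bullet> p" by (simp add: inner_add_right)
      moreover have "(k \<star> p - p) \<bullet> (k \<star> p - p) = 2 * (p \<bullet> p - (k \<star> p) \<bullet> p)"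
        using inner_apply[OF k(1), of p p] by (simp add: inner_simps inner_commute)
      ultimately have "k \<star> p = p"
        using inner_ge_zero[of "k \<star> p - p"] inner_eq_zero_iff[of "k \<star> p - p"] by simp
      then show "k \<in> stab p" using k by (simp add: stab_def)
    qed
    \<comment> \<open>By the maximal dimension of \<open>fixed p\<close> the inclusion is an
      equality, so \<open>stab p\<close> fixes \<open>p + ?y\<close> and thus
      \<open>?y\<close>.\<close>
    then have "fixed p \<subseteq> fixed (p + ?y)" by (auto simp: fixed_def)
    then have "fixed p = fixed (p + ?y)"
      using p[of "p + ?y"] by (intro subspace_dim_equal subspace_fixed)
    then have "p + ?y \<in> fixed p" by (simp add: fixed_def)
    then have "stab p \<subseteq> stab ?y" by (auto simp: fixed_def stab_def endo_simps)
    then show ?thesis using a(1) by blast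
  qed
  then show ?thesis by (auto simp: regular_def)
qed

end


section \<open>Linear sections\<close>

text \<open>A section as a linear subspace: \<open>meets\<close> is (C2), \<open>normal\<close> is
  the inclusion of normal spaces in (C3), expressed through the Lie algebra, and
  \<open>returns\<close> is (C4).\<close>

locale linear_section = compact_isometry_group +
  fixes S :: "'a set"
  assumes subspace: "subspace S"
    and meets: "\<exists>a\<in>K. a \<star> v \<in> S"
    and normal: "z \<in> S \<Longrightarrow> regular z \<Longrightarrow> (\<And>A. A \<in> lie \<Longrightarrow> (A \<star> z) \<bullet> y = 0) \<Longrightarrow> y \<in> S"
    and returns: "z \<in> S \<Longrightarrow> regular z \<Longrightarrow> a \<in> K \<Longrightarrow> a \<star> z \<in> S \<Longrightarrow> (\<star>) a ` S = S"
begin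

text \<open>Take \<open>z\<close> maximizing the inner product with \<open>q\<close> among the points of a regular orbit in \<open>S\<close>.
  Were \<open>q\<close> not normal to the orbit at \<open>z\<close>, the orbit would be transversal to \<open>S \<inter> q\<^sup>\<bottom>\<close>, and the
  open mapping theorem would give a point of the orbit in \<open>z + \<eta> q + S \<inter> q\<^sup>\<bottom>\<close> for some \<open>\<eta> > 0\<close>.\<close>

lemma exists_regular_normal:
  assumes q: "q \<in> S"
  shows "\<exists>z\<in>S. regular z \<and> (\<forall>A\<in>lie. (A \<star> z) \<bullet> q = 0)"
proof -
  obtain p0 where "regular p0" using regular_exists by blast
  moreover obtain a0 where "a0 \<in> K" "a0 \<star> p0 \<in> S" using meets by blast
  ultimately obtain z0 where z0: "z0 \<in> S" "regular z0" using regular_apply by blast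
  let ?C = "(\<lambda>a. a \<star> z0) ` K \<inter> S"
  have "compact ?C"
    by (intro compact_Int_closed compact_continuous_image compact closed_subspace subspace
        bounded_linear.continuous_on[OF endo.bounded_linear_left] continuous_intros)
  moreover have "z0 \<in> ?C" using one_mem z0(1) by (auto intro!: image_eqI[of _ _ 1])
  moreover have "continuous_on ?C (\<lambda>x. x \<bullet> q)" by (intro continuous_intros)
  ultimately obtain z where "z \<in> ?C" and max: "\<And>x. x \<in> ?C \<Longrightarrow> x \<bullet> q \<le> z \<bullet> q"
    using continuous_attains_sup[of ?C "\<lambda>x. x \<bullet> q"] by (metis empty_iff)
  then obtain a where z: "z \<in> S" "a \<in> K" "z = a \<star> z0" by auto
  have zreg: "regular z" using regular_apply[OF z0(2) z(2)] z(3) by simp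
  have "(A0 \<star> z) \<bullet> q = 0" if A0: "A0 \<in> lie" for A0
  proof (rule ccontr)
    assume A0q: "(A0 \<star> z) \<bullet> q \<noteq> 0"
    define T where "T = (\<lambda>A. A \<star> z) ` lie"
    define M where "M = {x \<in> S. x \<bullet> q = 0}"
    define W where "W = {x + y | x y. x \<in> T \<and> y \<in> M}"
    have T: "subspace T"
      unfolding T_def
      by (intro linear_subspace_image subspace_lie bounded_linear.linear[OF endo.bounded_linear_left])
    have M: "subspace M"
      unfolding M_def using subspace by (auto simp: subspace_def inner_simps)
    have W: "subspace W" unfolding W_def by (rule subspace_sums[OF T M])
    \<comment> \<open>A vector \<open>y\<close> orthogonal to \<open>W\<close> is normal to the
      orbit, so it lies in \<open>S\<close>; being orthogonal to \<open>M\<close>, it is a multiple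
      of \<open>q\<close>. But \<open>A0 \<star> z\<close> is orthogonal to \<open>y\<close> and not
      to \<open>q\<close>, so \<open>y = 0\<close>.\<close>
    have "W = UNIV"
    proof (rule ccontr)
      assume "W \<noteq> UNIV"
      then have "span W \<subset> UNIV" using W by (simp add: span_eq_iff[THEN iffD2] top.not_eq_extremum)
      then obtain y where y: "y \<noteq> 0" "\<And>x. x \<in> W \<Longrightarrow> orthogonal y x"
        using orthogonal_to_subspace_exists_gen[of W UNIV] by (metis span_UNIV span_base)
      have yT: "x \<bullet> y = 0" if "x \<in> T" for x
      proof -
        have "x \<in> W"
          unfolding W_def using that subspace_0[OF M] by (intro CollectI exI[of _ x] exI[of _ 0]) simp
        then show ?thesis using y(2) by (simp add: orthogonal_def inner_commute)
      qed
      have yM: "x \<bullet> y = 0" if "x \<in> M" for x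
      proof -
        have "x \<in> W"
          unfolding W_def using that subspace_0[OF T] by (intro CollectI exI[of _ 0] exI[of _ x]) simp
        then show ?thesis using y(2) by (simp add: orthogonal_def inner_commute)
      qed
      have yS: "y \<in> S" by (rule normal[OF z(1) zreg]) (auto simp: T_def intro: yT)
      have q0: "q \<bullet> q \<noteq> 0" using A0q by auto
      define c where "c = (y \<bullet> q) / (q \<bullet> q)"
      have "y - c *\<^sub>R q \<in> M"
        unfolding M_def using yS q subspace q0
        by (auto simp: subspace_diff subspace_scale c_def inner_diff_left)
      then have "(y - c *\<^sub>R q) \<bullet> y = 0" "(y - c *\<^sub>R q) \<bullet> q = 0"
        using yM by (auto simp: M_def)
      then have "(y - c *\<^sub>R q) \<bullet> (y - c *\<^sub>R q) = 0" by (simp add: inner_diff_right)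
      then have ycq: "y = c *\<^sub>R q" by simp
      have "(A0 \<star> z) \<bullet> y = 0" using A0 by (intro yT) (auto simp: T_def)
      then have "c = 0" using A0q by (simp add: ycq)
      then show False using y(1) ycq by simp
    qed
    have "\<exists>A c. A \<in> lie \<and> c \<in> M \<and> A \<star> z + c = i" for i
    proof -
      have "i \<in> W" by (simp add: \<open>W = UNIV\<close>)
      then obtain t c where "t \<in> T" "c \<in> M" "i = t + c" unfolding W_def by blast
      then show ?thesis unfolding T_def by auto
    qed
    then obtain A c where A: "\<And>i. A i \<in> lie" and c: "\<And>i. c i \<in> M" and Ac: "\<And>i. A i \<star> z + c i = i"
      by metis
    \<comment> \<open>Linear extension from the basis makes the solutions of
      \<open>A \<star> z + c = x\<close> depend linearly on \<open>x\<close>.\<close>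
    define A' where "A' = (\<lambda>x::'a. \<Sum>i\<in>Basis. (x \<bullet> i) *\<^sub>R A i)"
    define c' where "c' = (\<lambda>x::'a. \<Sum>i\<in>Basis. (x \<bullet> i) *\<^sub>R c i)"
    have A': "bounded_linear A'" and c': "bounded_linear c'"
      unfolding A'_def c'_def
      by (intro bounded_linear_sum bounded_linear_scaleR_left[THEN bounded_linear_compose]
          bounded_linear_inner_left)+
    have A'lie: "A' x \<in> lie" and c'M: "c' x \<in> M" for x
      unfolding A'_def c'_def
      by (intro subspace_sum subspace_scale subspace_lie M A c)+
    have sum: "A' x \<star> z + c' x = x" for x
    proof -
      have "A' x \<star> z + c' x = (\<Sum>i\<in>Basis. (x \<bullet> i) *\<^sub>R (A i \<star> z + c i))"
        by (simp add: A'_def c'_def endo.sum_left endo_simps scaleR_add_right sum.distrib)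
      then show ?thesis by (simp add: Ac euclidean_representation)
    qed
    \<comment> \<open>The map moves \<open>z\<close> along its orbit and then by a vector of
      \<open>M\<close>. By \<open>sum\<close> its derivative at zero is the identity, so its range
      is a neighbourhood of \<open>z\<close>.\<close>
    define f where "f = (\<lambda>x. exp (A' x) \<star> z + c' x)"
    have A0': "A' 0 = 0" and c0': "c' 0 = 0" by (simp_all add: A'_def c'_def)
    have "continuous_on UNIV f"
      unfolding f_def
      by (intro continuous_intros bounded_linear.continuous_on[OF endo.bounded_linear_left]
          continuous_on_compose2[OF continuous_at_imp_continuous_on[of UNIV exp]]
          linear_continuous_on A' c') (auto simp: isCont_exp_banach_algebra)
    moreover have "(f has_derivative (\<lambda>x. x)) (at 0)"
    proof -
      have "(A' has_derivative A') (at 0)" by (rule bounded_linear_imp_has_derivative[OF A'])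
      then have "((\<lambda>x. exp (A' x)) has_derivative A') (at 0)"
        using has_derivative_compose[of A' A' 0 UNIV exp "\<lambda>h. h"] exp_has_derivative_at_zero
        by (simp add: A0')
      then have "(f has_derivative (\<lambda>x. A' x \<star> z + c' x)) (at 0)"
        unfolding f_def
        by (intro has_derivative_add bounded_linear.has_derivative[OF endo.bounded_linear_left]
            bounded_linear_imp_has_derivative[OF c'])
      then show ?thesis by (simp add: sum)
    qed
    ultimately have "f 0 \<in> interior (range f)"
      by (intro sussmann_open_mapping[of UNIV f 0 "\<lambda>x. x" "\<lambda>x. x"]) auto
    then have "z \<in> interior (range f)" by (simp add: f_def A0' c0')
    then obtain e where e: "e > 0" "ball z e \<subseteq> range f" using mem_interior by blast
    define \<eta> where "\<eta> = e / (2 * (norm q + 1))"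
    have \<eta>: "\<eta> > 0" using e(1) norm_ge_zero[of q] by (simp add: \<eta>_def add_nonneg_pos)
    have "\<eta> * norm q < e"
    proof -
      have "\<eta> * norm q \<le> \<eta> * (norm q + 1)" using \<eta> by simp
      also have "\<dots> = e / 2"
      proof -
        have "norm q + 1 \<noteq> 0" using norm_ge_zero[of q] by linarith
        then show ?thesis by (simp add: \<eta>_def divide_simps)
      qed
      finally show ?thesis using e(1) by linarith
    qed
    then have "z + \<eta> *\<^sub>R q \<in> ball z e" using \<eta> by (simp add: dist_norm)
    then obtain x where x: "z + \<eta> *\<^sub>R q = exp (A' x) \<star> z + c' x"
      using e(2) unfolding f_def by blast
    \<comment> \<open>This orbit point lies in \<open>S\<close>, and as \<open>c' x\<close> is
      orthogonal to \<open>q\<close>, its inner product with \<open>q\<close> exceeds that of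
      \<open>z\<close>.\<close>
    have gz: "exp (A' x) \<star> z = z + \<eta> *\<^sub>R q - c' x" by (simp add: x)
    have "exp (A' x) \<star> z \<in> S"
      unfolding gz using z(1) q c'M[of x] subspace
      by (intro subspace_diff subspace_add subspace_scale) (auto simp: M_def)
    moreover have "exp (A' x) \<star> z = (exp (A' x) * a) \<star> z0" by (simp add: z(3) endo_mult)
    moreover have "exp (A' x) * a \<in> K"
      using exp_mem[OF A'lie, of 1] z(2) by (simp add: mult_mem)
    ultimately have "(exp (A' x) \<star> z) \<bullet> q \<le> z \<bullet> q"
      by (intro max IntI) (auto intro: image_eqI)
    moreover have "(exp (A' x) \<star> z) \<bullet> q = z \<bullet> q + \<eta> * (q \<bullet> q)"
      using c'M[of x] unfolding gz by (simp add: M_def inner_simps)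
    ultimately have "\<eta> * (q \<bullet> q) \<le> 0" by simp
    moreover have "0 < \<eta> * (q \<bullet> q)" using A0q \<eta> by (intro mult_pos_pos) auto
    ultimately show False by simp
  qed
  then show ?thesis using z(1) zreg by blast
qed

text \<open>Along the line from \<open>z\<close> to \<open>q\<close>, normal to the orbits, a point near \<open>q\<close> has its isotropy
  group contained in that of \<open>q\<close>; this group then fixes the whole line and so \<open>z\<close>.\<close>

lemma regular_dense:
  assumes q: "q \<in> S" and "0 < e"
  shows "\<exists>x\<in>S. regular x \<and> dist x q < e"
proof -
  obtain z where z: "z \<in> S" "regular z" "\<And>A. A \<in> lie \<Longrightarrow> (A \<star> z) \<bullet> q = 0"
    using exists_regular_normal[OF q] by blast
  define w where "w = q - z"
  \<comment> \<open>Skewness gives \<open>(A \<star> q) \<bullet> q = 0\<close> and turns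
    \<open>(A \<star> q) \<bullet> z\<close> into \<open>- ((A \<star> z) \<bullet> q)\<close>, so
    normality at \<open>z\<close> carries over to \<open>q\<close>.\<close>
  have "(A \<star> q) \<bullet> w = 0" if "A \<in> lie" for A
    using lie_skew[OF that, of q] lie_skew'[OF that, of q z] z(3)[OF that]
    by (simp add: w_def inner_diff_right)
  then obtain d where d: "d > 0" "\<And>s. \<bar>s\<bar> < d \<Longrightarrow> stab (q + s *\<^sub>R w) \<subseteq> stab q"
    using stab_normal_line by metis
  define s where "s = min (d / 2) (e / (2 * (norm w + 1)))"
  have n: "norm w + 1 > 0" using norm_ge_zero[of w] by linarith
  have s: "0 < s" "\<bar>s\<bar> < d" using d(1) \<open>0 < e\<close> n by (auto simp: s_def)
  have "s * norm w < e"
  proof -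
    have "s * norm w \<le> s * (norm w + 1)" using s by simp
    also have "\<dots> \<le> e / (2 * (norm w + 1)) * (norm w + 1)"
      using n by (intro mult_right_mono) (auto simp: s_def)
    also have "\<dots> = e / 2" using n by (simp add: divide_simps)
    finally show ?thesis using \<open>0 < e\<close> by linarith
  qed
  then have "dist (q + s *\<^sub>R w) q < e" using s by (simp add: dist_norm)
  moreover have "q + s *\<^sub>R w \<in> S"
    unfolding w_def using q z(1) subspace by (intro subspace_add subspace_scale subspace_diff)
  moreover have "stab (q + s *\<^sub>R w) \<subseteq> stab z"
  proof
    fix k assume k: "k \<in> stab (q + s *\<^sub>R w)"
    then have kq: "k \<star> q = q" using d(2)[OF s(2)] by (auto simp: stab_def)
    then have "s *\<^sub>R (k \<star> w) = s *\<^sub>R w" using k by (auto simp: stab_def endo_simps)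
    then have "k \<star> w = w" using s(1) by simp
    then have "k \<star> z = z" using kq by (simp add: w_def endo_simps)
    then show "k \<in> stab z" using k by (simp add: stab_def)
  qed
  ultimately show ?thesis using regular_mono[OF z(2)] by blast
qed

text \<open>One inclusion holds because \<open>S\<close> is closed; it is an equality because
  \<open>l\<close> is injective and preserves the dimension.\<close>

lemma stabilizer_limit:
  assumes k: "\<And>n. k n \<in> K" "\<And>n. (\<star>) (k n) ` S = S" and lim: "k \<longlonglongrightarrow> l" and l: "l \<in> K"
  shows "(\<star>) l ` S = S"
proof -
  have sub: "l \<star> x \<in> S" if "x \<in> S" for x
  proof (rule closed_sequentially[OF closed_subspace[OF subspace]])
    show "(\<lambda>n. k n \<star> x) \<longlonglongrightarrow> l \<star> x" by (intro endo_tendsto lim tendsto_const)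
    show "k n \<star> x \<in> S" for n using k(2) that by blast
  qed
  obtain l' where l': "\<And>x. l' \<star> l \<star> x = x" using obtain_inverse[OF l] by metis
  show ?thesis
  proof (rule subspace_dim_equal[OF _ subspace])
    have lin: "linear ((\<star>) l)" by (rule bounded_linear.linear[OF endo.bounded_linear_right])
    then show "subspace ((\<star>) l ` S)" by (rule linear_subspace_image[OF _ subspace])
    show "(\<star>) l ` S \<subseteq> S" using sub by blast
    have "inj ((\<star>) l)" by (metis injI l')
    then show "dim S \<le> dim ((\<star>) l ` S)"
      using dim_image_eq[OF lin] by (simp add: inj_on_subset)
  qed
qed

text \<open>This makes the map of orbit spaces injective. (C4) applies at regular points only, so
  \<open>p\<close> and \<open>g \<star> p\<close> are approximated by such points, and compactness
  of \<open>K\<close> supplies a limit.\<close>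

theorem orbit_eq_stabilizer_orbit:
  assumes p: "p \<in> S" and g: "g \<in> K" "g \<star> p \<in> S"
  shows "\<exists>h\<in>K. (\<star>) h ` S = S \<and> h \<star> p = g \<star> p"
proof -
  obtain g' where g': "g' \<in> K" "\<And>x. g \<star> g' \<star> x = x" "\<And>x. g' \<star> g \<star> x = x"
    using obtain_inverse[OF g(1)] by metis
  have "\<exists>x y. x \<in> S \<and> regular x \<and> dist x p < inverse (real (Suc n))
      \<and> y \<in> S \<and> regular y \<and> dist y (g \<star> p) < inverse (real (Suc n))" for n
    using regular_dense[OF p, of "inverse (real (Suc n))"]
      regular_dense[OF g(2), of "inverse (real (Suc n))"] by auto
  then obtain x y where x: "\<And>n. x n \<in> S" "\<And>n. regular (x n)" "\<And>n. dist (x n) p < inverse (real (Suc n))"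
    and y: "\<And>n. y n \<in> S" "\<And>n. regular (y n)" "\<And>n. dist (y n) (g \<star> p) < inverse (real (Suc n))"
    by metis
  have "\<exists>h\<in>K. (\<star>) (g * h) ` S = S \<and> norm (h \<star> x n - g' \<star> y n) \<le> norm (x n - g' \<star> y n)" for n
  proof -
    obtain h where h: "h \<in> K" "\<And>b. b \<in> K \<Longrightarrow> (b \<star> x n) \<bullet> (g' \<star> y n) \<le> (h \<star> x n) \<bullet> (g' \<star> y n)"
      using obtain_max_inner by blast
    obtain h' where h': "h' \<in> K" "\<And>x. h \<star> h' \<star> x = x" "\<And>x y. (h \<star> x) \<bullet> y = x \<bullet> (h' \<star> y)"
      using obtain_inverse[OF h(1)] by metis
    \<comment> \<open>After moving by the inverse of \<open>h\<close>, the maximum is attained at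
      \<open>x n\<close> itself, so \<open>u\<close> is normal to the orbit there and lies in
      \<open>S\<close>. As \<open>g * h\<close> maps the regular point \<open>u\<close> to
      \<open>y n\<close>, \<open>returns\<close> applies.\<close>
    define u where "u = h' \<star> g' \<star> y n"
    have "u \<in> S"
    proof (rule normal[OF x(1,2)])
      fix A assume "A \<in> lie"
      then show "(A \<star> x n) \<bullet> u = 0"
      proof (rule lie_orthogonal_of_max)
        fix b assume "b \<in> K"
        then show "(b \<star> x n) \<bullet> u \<le> x n \<bullet> u"
          using h(2)[OF mult_mem[OF h(1)]] by (simp add: u_def endo_mult h'(3))
      qed
    qed
    moreover have "regular u"
      unfolding u_def by (intro regular_apply y h' g')
    moreover have "(g * h) \<star> u = y n" by (simp add: u_def endo_mult h' g')
    ultimately have "(\<star>) (g * h) ` S = S"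
      using y(1)[of n] g(1) h(1) by (intro returns[of u]) (simp_all add: mult_mem)
    moreover have "norm (h \<star> x n - g' \<star> y n) \<le> norm (x n - g' \<star> y n)"
    proof (rule power2_le_imp_le)
      show "(norm (h \<star> x n - g' \<star> y n))\<^sup>2 \<le> (norm (x n - g' \<star> y n))\<^sup>2"
        using h(2)[OF one_mem] inner_apply[OF h(1), of "x n" "x n"]
        by (simp add: power2_norm_eq_inner inner_diff_left inner_diff_right inner_commute)
    qed simp
    ultimately show ?thesis using h(1) by blast
  qed
  then obtain h where h: "\<And>n. h n \<in> K" "\<And>n. (\<star>) (g * h n) ` S = S"
    and hn: "\<And>n. norm (h n \<star> x n - g' \<star> y n) \<le> norm (x n - g' \<star> y n)" by metis
  have x0: "x \<longlonglongrightarrow> p" and y0: "y \<longlonglongrightarrow> g \<star> p"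
    using x(3) y(3) unfolding tendsto_dist_iff[of x] tendsto_dist_iff[of y]
    by (intro Lim_null_comparison[OF always_eventually LIMSEQ_inverse_real_of_nat];
        simp del: of_nat_Suc add: less_imp_le)+
  have gy: "(\<lambda>n. g' \<star> y n) \<longlonglongrightarrow> p"
    using endo_tendsto[OF tendsto_const y0, of g'] by (simp add: g')
  obtain r l where r: "strict_mono r" and l: "l \<in> K" and hl: "(\<lambda>n. h (r n)) \<longlonglongrightarrow> l"
    using convergent_subsequence[of h, OF h(1)] by blast
  have xr: "(\<lambda>n. x (r n)) \<longlonglongrightarrow> p" and gyr: "(\<lambda>n. g' \<star> y (r n)) \<longlonglongrightarrow> p"
    using LIMSEQ_subseq_LIMSEQ[OF x0 r] LIMSEQ_subseq_LIMSEQ[OF gy r] by (simp_all add: comp_def)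
  \<comment> \<open>Both \<open>x (r n)\<close> and \<open>g' \<star> y (r n)\<close> tend to
    \<open>p\<close>, so the right-hand side of \<open>hn\<close> tends to zero. Hence
    \<open>g * l\<close> still maps \<open>p\<close> to \<open>g \<star> p\<close>.\<close>
  have "l \<star> p = p"
  proof -
    have 1: "(\<lambda>n. norm (h (r n) \<star> x (r n) - g' \<star> y (r n))) \<longlonglongrightarrow> norm (l \<star> p - p)"
      by (intro tendsto_intros endo_tendsto hl xr gyr)
    have 2: "(\<lambda>n. norm (x (r n) - g' \<star> y (r n))) \<longlonglongrightarrow> norm (p - p)"
      by (intro tendsto_intros xr gyr)
    have "norm (l \<star> p - p) \<le> norm (p - p)"
      by (rule LIMSEQ_le[OF 1 2]) (use hn in blast)
    then show ?thesis by simp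
  qed
  moreover have "(\<star>) (g * l) ` S = S"
  proof (rule stabilizer_limit)
    show "(\<lambda>n. g * h (r n)) \<longlonglongrightarrow> g * l" by (intro tendsto_intros hl)
  qed (simp_all add: h mult_mem g l)
  ultimately show ?thesis
    using g(1) l by (intro bexI[of _ "g * l"]) (simp_all add: endo_mult mult_mem)
qed

end


section \<open>Complete totally geodesic submanifolds of a Euclidean space\<close>

lemma has_derivative_cong_open:
  assumes "open U" "x \<in> U" "\<And>y. y \<in> U \<Longrightarrow> f y = g y"
  shows "(f has_derivative D) (at x) \<longleftrightarrow> (g has_derivative D) (at x)"
  using has_derivative_transform_within_open[OF _ assms(1,2), of f D UNIV g]
    has_derivative_transform_within_open[OF _ assms(1,2), of g D UNIV f] assms(3) by auto

lemma Ck_on_cong: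
  assumes "open U"
  shows "(\<And>x. x \<in> U \<Longrightarrow> f x = g x) \<Longrightarrow> Ck_on n U f \<longleftrightarrow> Ck_on n U g"
proof (induction n arbitrary: f g)
  case (Suc n)
  note eq = has_derivative_cong_open[OF assms _ Suc.prems]
  have "frechet_derivative f (at x) = frechet_derivative g (at x)" if "x \<in> U" for x
    unfolding frechet_derivative_def by (simp add: eq that)
  then have "Ck_on n U (\<lambda>x. frechet_derivative f (at x) v) \<longleftrightarrow> Ck_on n U (\<lambda>x. frechet_derivative g (at x) v)" for v
    by (intro Suc.IH) simp
  moreover have "f differentiable (at x) \<longleftrightarrow> g differentiable (at x)" if "x \<in> U" for x
    by (simp add: differentiable_def eq that)
  ultimately show ?case by simp
qed (simp cong: continuous_on_cong)

text \<open>For an affine inner map, a derivative of the composite is the composite with a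
  directional derivative of \<open>f\<close> in a fixed direction, so induction over all
  \<open>f\<close> suffices.\<close>

lemma Ck_on_compose_line:
  assumes "open I" and "\<And>t. t \<in> I \<Longrightarrow> c + t *\<^sub>R w \<in> U"
  shows "Ck_on n U f \<Longrightarrow> Ck_on n I (\<lambda>t. f (c + t *\<^sub>R w))"
proof (induction n arbitrary: f)
  case 0
  then show ?case
    using assms(2) by (auto intro!: continuous_on_compose2[of U f] continuous_intros)
next
  case (Suc n)
  have der: "((\<lambda>t. f (c + t *\<^sub>R w)) has_derivative (\<lambda>s. frechet_derivative f (at (c + t *\<^sub>R w)) (s *\<^sub>R w))) (at t)"
    if "t \<in> I" for t
  proof (rule has_derivative_compose[of "\<lambda>t. c + t *\<^sub>R w" "\<lambda>s. s *\<^sub>R w" t UNIV f])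
    show "((\<lambda>t. c + t *\<^sub>R w) has_derivative (\<lambda>s. s *\<^sub>R w)) (at t)"
      by (auto intro!: derivative_eq_intros)
    show "(f has_derivative frechet_derivative f (at (c + t *\<^sub>R w))) (at (c + t *\<^sub>R w))"
      using Suc.prems assms(2)[OF that] by (simp add: frechet_derivative_works)
  qed
  have "Ck_on n I (\<lambda>t. frechet_derivative (\<lambda>t. f (c + t *\<^sub>R w)) (at t) s)" for s
  proof -
    have "Ck_on n I (\<lambda>t. frechet_derivative f (at (c + t *\<^sub>R w)) (s *\<^sub>R w))"
      using Suc.prems by (intro Suc.IH) simp
    moreover have "frechet_derivative (\<lambda>t. f (c + t *\<^sub>R w)) (at t) s = frechet_derivative f (at (c + t *\<^sub>R w)) (s *\<^sub>R w)"
      if "t \<in> I" for t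
      using frechet_derivative_at[OF der[OF that]] by metis
    ultimately show ?thesis using Ck_on_cong[OF assms(1)] by (metis (no_types, lifting))
  qed
  then show ?case using der by (auto simp: differentiable_def)
qed

lemma smooth_on_compose_line:
  "open I \<Longrightarrow> (\<And>t. t \<in> I \<Longrightarrow> c + t *\<^sub>R w \<in> U) \<Longrightarrow> smooth_on U f \<Longrightarrow> smooth_on I (\<lambda>t. f (c + t *\<^sub>R w))"
  unfolding smooth_on_def using Ck_on_compose_line by blast

lemma smooth_on_imp_continuous_on: "smooth_on U f \<Longrightarrow> continuous_on U f"
  unfolding smooth_on_def by (metis Ck_on.simps(1))

lemma smooth_on_imp_has_derivative:
  "smooth_on U f \<Longrightarrow> x \<in> U \<Longrightarrow> (f has_derivative frechet_derivative f (at x)) (at x)"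
  unfolding smooth_on_def using Ck_on.simps(2)[of 0 U f] by (metis frechet_derivative_works)

lemma smooth_curve_has_vector_derivative:
  "smooth_curve X I \<gamma> \<Longrightarrow> t \<in> I \<Longrightarrow> (\<gamma> has_vector_derivative vector_derivative \<gamma> (at t)) (at t)"
  unfolding smooth_curve_def
  using smooth_on_imp_has_derivative vector_derivative_works differentiableI by metis

lemma geodesic_euclidean_line:
  fixes \<gamma> :: "real \<Rightarrow> 'a::euclidean_space"
  assumes "geodesic euclidean UNIV \<gamma>"
  shows "\<gamma> t = \<gamma> 0 + t *\<^sub>R vector_derivative \<gamma> (at 0)"
proof -
  let ?\<gamma>' = "\<lambda>t. vector_derivative \<gamma> (at t)"
  have sc: "smooth_curve euclidean UNIV \<gamma>" and acc: "\<And>t. vector_derivative ?\<gamma>' (at t) = 0"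
    using assms by (auto simp: geodesic_euclidean acceleration_def)
  have d1: "(\<gamma> has_vector_derivative ?\<gamma>' t) (at t)" for t
    by (rule smooth_curve_has_vector_derivative[OF sc]) simp
  have "?\<gamma>' t = frechet_derivative \<gamma> (at t) 1" for t
    using frechet_derivative_at[OF d1[unfolded has_vector_derivative_def], of t] by (metis scaleR_one)
  moreover have "Ck_on (Suc (Suc 0)) UNIV \<gamma>"
    using sc by (simp add: smooth_curve_def smooth_on_def del: Ck_on.simps)
  ultimately have "?\<gamma>' differentiable (at t)" for t by simp
  then have d2: "(?\<gamma>' has_vector_derivative 0) (at t)" for t
    using acc by (metis vector_derivative_works)
  have c: "?\<gamma>' t = ?\<gamma>' 0" for t
    using has_vector_derivative_zero_constant[of UNIV ?\<gamma>'] d2 by (metis convex_UNIV UNIV_I)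
  have "((\<lambda>t. \<gamma> t - t *\<^sub>R ?\<gamma>' 0) has_vector_derivative 0) (at t)" for t
    using d1[of t] unfolding c[of t] by (auto intro!: derivative_eq_intros)
  then have "\<gamma> t - t *\<^sub>R ?\<gamma>' 0 = \<gamma> 0 - 0 *\<^sub>R ?\<gamma>' 0"
    using has_vector_derivative_zero_constant[of UNIV "\<lambda>t. \<gamma> t - t *\<^sub>R ?\<gamma>' 0"] by (metis convex_UNIV UNIV_I)
  then show ?thesis by (simp add: algebra_simps)
qed

text \<open>Completeness extends the geodesic to all times, and being totally geodesic makes it a
  straight line. The gain is continuity into \<open>X\<close>, whose topology may a priori be finer
  than the Euclidean one.\<close>

lemma continuous_map_tangent_line:
  assumes "geodesically_complete X" "totally_geodesic X" "p \<in> topspace X" "v \<in> tangent_space X p"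
  shows "continuous_map euclidean X (\<lambda>t. p + t *\<^sub>R v)"
proof -
  obtain \<gamma> where \<gamma>: "geodesic X UNIV \<gamma>" "\<gamma> 0 = p" "vector_derivative \<gamma> (at 0) = v"
    using assms unfolding geodesically_complete_def by blast
  then have "geodesic euclidean UNIV \<gamma>" using assms(2) unfolding totally_geodesic_def by blast
  then have "\<gamma> = (\<lambda>t. p + t *\<^sub>R v)" using geodesic_euclidean_line \<gamma> by blast
  moreover have "continuous_map euclidean X \<gamma>"
    using \<gamma>(1) by (simp add: geodesic_def smooth_curve_def)
  ultimately show ?thesis by simp
qed

section \<open>From local flatness to a global affine subspace\<close>

text \<open>A tangent line stays in a slice neighbourhood \<open>W\<close> as long as it stays in the domain \<open>N\<close> of
  the slice chart, because \<open>W\<close> is open in \<open>X\<close> and relatively closed in \<open>N\<close>. So \<open>W\<close> contains a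
  neighbourhood of \<open>p\<close> in its affine tangent space, which is open in \<open>X\<close> by invariance of domain.\<close>

lemma submanifold_locally_flat:
  fixes X :: "'a::euclidean_space topology"
  assumes "submanifold X m" "geodesically_complete X" "totally_geodesic X" "p \<in> topspace X"
  obtains S r where "subspace S" "dim S = m" "r > 0" "S \<subseteq> tangent_space X p"
    "openin X ((+) p ` (S \<inter> ball 0 r))"
    "subtopology X ((+) p ` (S \<inter> ball 0 r)) = top_of_set ((+) p ` (S \<inter> ball 0 r))"
proof -
  obtain W N \<phi> L where W: "openin X W" "p \<in> W" "subtopology X W = top_of_set W" "W \<subseteq> N"
    and \<phi>: "diffeomorphism_on N \<phi>" and L: "subspace L" "dim L = m" and \<phi>W: "\<phi> ` W = \<phi> ` N \<inter> L"
    using assms(1,4) unfolding submanifold_def by metis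
  define \<psi> where "\<psi> = inv_into N \<phi>"
  have N: "open N" "open (\<phi> ` N)" "inj_on \<phi> N" "smooth_on N \<phi>" "smooth_on (\<phi> ` N) \<psi>"
    using \<phi> by (auto simp: diffeomorphism_on_def \<psi>_def)
  have \<psi>\<phi>: "\<psi> (\<phi> x) = x" if "x \<in> N" for x using N(3) that by (simp add: \<psi>_def)
  have W_iff: "x \<in> W \<longleftrightarrow> \<phi> x \<in> L" if "x \<in> N" for x
    using \<phi>W W(4) N(3) that by (auto simp: inj_on_def)
  have pN: "p \<in> N" using W by blast
  define D where "D = frechet_derivative \<psi> (at (\<phi> p))"
  have D: "(\<psi> has_derivative D) (at (\<phi> p))"
    unfolding D_def using N(5) pN by (intro smooth_on_imp_has_derivative) auto
  define D' where "D' = frechet_derivative \<phi> (at p)"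
  have D': "(\<phi> has_derivative D') (at p)"
    unfolding D'_def using N(4) pN by (intro smooth_on_imp_has_derivative) auto
  \<comment> \<open>The left inverse makes \<open>D\<close> injective, so its image of
    \<open>L\<close> has dimension \<open>m\<close>.\<close>
  have D'D: "D' (D w) = w" for w
  proof -
    have "((\<lambda>x. \<phi> (\<psi> x)) has_derivative (\<lambda>w. D' (D w))) (at (\<phi> p))"
      using has_derivative_compose[OF D, of \<phi> D'] D' by (simp add: \<psi>\<phi> pN)
    then have "((\<lambda>x. x) has_derivative (\<lambda>w. D' (D w))) (at (\<phi> p))"
      by (rule has_derivative_transform_within_open[OF _ N(2)]) (use pN \<psi>\<phi> in auto)
    then have "(\<lambda>w. D' (D w)) = (\<lambda>w. w)" using has_derivative_unique has_derivative_ident by blast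
    then show ?thesis by metis
  qed
  define S where "S = D ` L"
  have linD: "linear D" using D by (rule has_derivative_linear)
  have S: "subspace S" unfolding S_def by (rule linear_subspace_image[OF linD L(1)])
  have dimS: "dim S = m"
    unfolding S_def using dim_image_eq[OF linD, of L] L(2) D'D by (metis inj_onI)
  have tangent: "S \<subseteq> tangent_space X p"
  proof
    fix v assume "v \<in> S"
    then obtain w where w: "w \<in> L" "v = D w" by (auto simp: S_def)
    obtain e where e: "e > 0" "ball (\<phi> p) e \<subseteq> \<phi> ` N"
      using N(2) pN by (meson imageI open_contains_ball)
    define I where "I = ball (0::real) (e / (norm w + 1))"
    have n: "norm w + 1 > 0" using norm_ge_zero[of w] by linarith
    have I0: "0 \<in> I" using e(1) n by (simp add: I_def)
    have I: "\<phi> p + t *\<^sub>R w \<in> \<phi> ` N" if "t \<in> I" for t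
    proof -
      have "\<bar>t\<bar> * norm w \<le> \<bar>t\<bar> * (norm w + 1)" by (simp add: algebra_simps)
      also have "\<dots> < e" using that n by (simp add: I_def field_simps)
      finally show ?thesis using e(2) by (auto simp: dist_norm subset_iff)
    qed
    \<comment> \<open>The chart pulls a line in \<open>L\<close> back to a curve in \<open>W\<close>
      with velocity \<open>D w\<close>.\<close>
    define \<gamma> where "\<gamma> = (\<lambda>t. \<psi> (\<phi> p + t *\<^sub>R w))"
    have smooth: "smooth_on I \<gamma>"
      unfolding \<gamma>_def by (rule smooth_on_compose_line[OF _ I N(5)]) (simp add: I_def)
    have "\<gamma> t \<in> W" if "t \<in> I" for t
    proof -
      obtain x where x: "x \<in> N" "\<phi> p + t *\<^sub>R w = \<phi> x" using I[OF \<open>t \<in> I\<close>] by blast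
      have "\<phi> p + t *\<^sub>R w \<in> L"
        using W_iff[OF pN] W(2) w(1) L(1) by (intro subspace_add subspace_scale) auto
      then show ?thesis using x W_iff by (simp add: \<gamma>_def \<psi>\<phi>)
    qed
    then have "continuous_map (top_of_set I) (subtopology X W) \<gamma>"
      unfolding W(3) using smooth_on_imp_continuous_on[OF smooth] by auto
    then have "continuous_map (top_of_set I) X \<gamma>" by (simp add: continuous_map_in_subtopology)
    then have "smooth_curve X I \<gamma>"
      using smooth by (simp add: smooth_curve_def I_def is_interval_ball_real)
    moreover have "\<gamma> 0 = p" by (simp add: \<gamma>_def \<psi>\<phi> pN)
    moreover have "vector_derivative \<gamma> (at 0) = v"
    proof (rule vector_derivative_at)
      have "((\<lambda>t. \<phi> p + t *\<^sub>R w) has_derivative (\<lambda>s. s *\<^sub>R w)) (at 0)"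
        by (auto intro!: derivative_eq_intros)
      then have "(\<gamma> has_derivative (\<lambda>s. D (s *\<^sub>R w))) (at 0)"
        unfolding \<gamma>_def using has_derivative_compose[of _ _ 0 UNIV \<psi> D] D by fastforce
      then show "(\<gamma> has_vector_derivative v) (at 0)"
        by (simp add: has_vector_derivative_def w(2) linear_scale[OF linD])
    qed
    ultimately show "v \<in> tangent_space X p" using I0 unfolding tangent_space_def by blast
  qed
  obtain r where r: "r > 0" "ball p r \<subseteq> N" using N(1) pN open_contains_ball by blast
  let ?B = "S \<inter> ball 0 r"
  let ?O = "(+) p ` ?B"
  have segment: "p + v \<in> W" if v: "v \<in> ?B" for v
  proof -
    let ?l = "\<lambda>t::real. p + t *\<^sub>R v"
    have lN: "?l t \<in> N" if "t \<in> {0..1}" for t :: real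
    proof -
      have "\<bar>t\<bar> * norm v \<le> 1 * norm v" using that by (intro mult_right_mono) auto
      then have "dist p (?l t) < r" using v by (simp add: dist_norm)
      then show ?thesis using r(2) by auto
    qed
    let ?A = "{t \<in> {0..1}. ?l t \<in> W}"
    have "continuous_map euclidean X ?l"
      using assms tangent v by (intro continuous_map_tangent_line) auto
    then have "open {t. ?l t \<in> W}"
      using openin_continuous_map_preimage[OF _ W(1), of euclidean ?l] by simp
    then have "openin (top_of_set {0..1}) ({0..1} \<inter> {t. ?l t \<in> W})" by (rule openin_open_Int)
    then have "openin (top_of_set {0..1}) ?A" by (simp add: Int_def)
    moreover have "closedin (top_of_set {0..1}) ?A"
    proof -
      have "continuous_on {0..1} (\<lambda>t. \<phi> (?l t))"
        using lN by (intro continuous_on_compose2[OF smooth_on_imp_continuous_on[OF N(4)]] continuous_intros) auto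
      then have "closedin (top_of_set {0..1}) ({0..1} \<inter> (\<lambda>t. \<phi> (?l t)) -` L)"
        by (rule continuous_closedin_preimage[OF _ closed_subspace[OF L(1)]])
      moreover have "{0..1} \<inter> (\<lambda>t. \<phi> (?l t)) -` L = ?A" using lN W_iff by auto
      ultimately show ?thesis by simp
    qed
    moreover have "connected {0..1::real}" by simp
    ultimately have "?A = {} \<or> ?A = {0..1}" unfolding connected_clopen by blast
    moreover have "0 \<in> ?A" using W(2) by simp
    ultimately have "?A = {0..1}" by blast
    moreover have "(1::real) \<in> {0..1}" by simp
    ultimately have "1 \<in> ?A" by (simp only:)
    then show ?thesis by simp
  qed
  then have OW: "?O \<subseteq> W" by auto
  have "openin (top_of_set L) ((\<lambda>v. \<phi> (p + v)) ` ?B)"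
  proof (rule invariance_of_domain_subspaces[OF _ S L(1)])
    show "openin (top_of_set S) ?B" by (simp add: openin_open_Int)
    show "dim L \<le> dim S" using L(2) dimS by simp
    show "continuous_on ?B (\<lambda>v. \<phi> (p + v))"
      using OW W(4) by (intro continuous_on_compose2[OF smooth_on_imp_continuous_on[OF N(4)]] continuous_intros) auto
    show "(\<lambda>v. \<phi> (p + v)) \<in> ?B \<rightarrow> L"
    proof
      fix v assume "v \<in> ?B"
      from segment[OF this] show "\<phi> (p + v) \<in> L" using W(4) W_iff by blast
    qed
    show "inj_on (\<lambda>v. \<phi> (p + v)) ?B"
    proof (rule inj_onI)
      fix x y assume "x \<in> ?B" "y \<in> ?B" "\<phi> (p + x) = \<phi> (p + y)"
      then have "p + x = p + y"
        by (intro inj_onD[OF N(3) _ subsetD[OF W(4) segment] subsetD[OF W(4) segment]])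
      then show "x = y" by simp
    qed
  qed
  moreover have "continuous_on W \<phi>" "\<phi> \<in> W \<rightarrow> L"
    using continuous_on_subset[OF smooth_on_imp_continuous_on[OF N(4)] W(4)] W(4) W_iff by auto
  ultimately have "openin (top_of_set W) (W \<inter> \<phi> -` ((\<lambda>v. \<phi> (p + v)) ` ?B))"
    by (intro continuous_openin_preimage)
  also have "W \<inter> \<phi> -` ((\<lambda>v. \<phi> (p + v)) ` ?B) = ?O"
  proof
    show "W \<inter> \<phi> -` ((\<lambda>v. \<phi> (p + v)) ` ?B) \<subseteq> ?O"
    proof
      fix x assume "x \<in> W \<inter> \<phi> -` ((\<lambda>v. \<phi> (p + v)) ` ?B)"
      then obtain v where v: "x \<in> W" "v \<in> ?B" "\<phi> x = \<phi> (p + v)" by auto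
      then have "x = p + v"
        by (intro inj_onD[OF N(3) _ subsetD[OF W(4)] subsetD[OF W(4) segment]])
      then show "x \<in> ?O" using v by blast
    qed
    show "?O \<subseteq> W \<inter> \<phi> -` ((\<lambda>v. \<phi> (p + v)) ` ?B)" using OW by auto
  qed
  finally have openO: "openin X ?O"
    unfolding W(3)[symmetric] using W(1) by (simp add: openin_open_subtopology)
  have "subtopology X ?O = top_of_set ?O"
  proof -
    have "subtopology X ?O = subtopology (subtopology X W) ?O"
      using OW by (simp add: subtopology_subtopology Int_absorb1)
    then show ?thesis unfolding W(3) using OW by (simp add: subtopology_subtopology Int_absorb1)
  qed
  then show thesis by (rule that[OF S dimS r(1) tangent openO])
qed

text \<open>Near \<open>p\<close> the submanifold is an open piece of an affine space with direction
  \<open>S\<close>. Tangent lines at points of this piece stay in it for short times, so their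
  directions lie in \<open>S\<close>; equality of dimensions does the rest.\<close>

lemma submanifold_tangent_locally_constant:
  fixes X :: "'a::euclidean_space topology"
  assumes X: "submanifold X m" "geodesically_complete X" "totally_geodesic X" and p: "p \<in> topspace X"
  shows "subspace (tangent_space X p)"
    and "\<exists>U. openin X U \<and> p \<in> U \<and> subtopology X U = top_of_set U
      \<and> openin (top_of_set ((+) p ` tangent_space X p)) U
      \<and> (\<forall>q\<in>U. tangent_space X q = tangent_space X p)"
proof -
  let ?T = "tangent_space X"
  have flat: "\<exists>S. subspace S \<and> dim S = m \<and> ?T q = S \<and>
      (\<exists>U. openin X U \<and> q \<in> U \<and> subtopology X U = top_of_set U \<and> openin (top_of_set ((+) q ` S)) U \<and>
        (\<forall>u\<in>U. ?T u \<subseteq> S))" if q: "q \<in> topspace X" for q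
  proof -
    obtain S r where S: "subspace S" "dim S = m" "r > 0" "S \<subseteq> ?T q"
      and op: "openin X ((+) q ` (S \<inter> ball 0 r))"
      and top: "subtopology X ((+) q ` (S \<inter> ball 0 r)) = top_of_set ((+) q ` (S \<inter> ball 0 r))"
      using submanifold_locally_flat[OF X q] by metis
    let ?U = "(+) q ` (S \<inter> ball 0 r)"
    have TS: "?T u \<subseteq> S" if u: "u \<in> ?U" for u
    proof
      fix v assume v: "v \<in> ?T u"
      have "u \<in> topspace X" using openin_subset[OF op] u by blast
      then have "open {t. u + t *\<^sub>R v \<in> ?U}"
        using openin_continuous_map_preimage[OF continuous_map_tangent_line[OF X(2,3) _ v] op] by simp
      moreover have "0 \<in> {t. u + t *\<^sub>R v \<in> ?U}" using u by simp
      ultimately obtain e where e: "e > 0" "ball 0 e \<subseteq> {t. u + t *\<^sub>R v \<in> ?U}"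
        using open_contains_ball by blast
      have "e / 2 \<in> ball 0 e" using e(1) by simp
      then have "u + (e / 2) *\<^sub>R v \<in> ?U" using e(2) by blast
      then obtain s where s: "s \<in> S" "u + (e / 2) *\<^sub>R v = q + s" by blast
      obtain s' where s': "s' \<in> S" "u = q + s'" using u by blast
      have "(e / 2) *\<^sub>R v = s - s'" using s s' by (simp add: algebra_simps)
      then have "v = (2 / e) *\<^sub>R (s - s')" using e(1) by (metis (no_types, lifting) divide_self_if
            less_irrefl scaleR_one scaleR_scaleR times_divide_times_eq mult.commute zero_neq_numeral no_zero_divisors)
      then show "v \<in> S" using s s' S(1) by (simp add: subspace_diff subspace_scale)
    qed
    have qU: "q \<in> ?U" using S(1,3) by (auto simp: subspace_0 intro!: image_eqI[of _ _ 0])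
    have eq: "?T q = S" using S(4) TS[OF qU] by blast
    have "?U = ((+) q ` S) \<inter> ball q r" by (auto simp: dist_norm)
    then have "openin (top_of_set ((+) q ` S)) ?U" by (simp add: openin_open_Int)
    with S eq op top TS qU show ?thesis by blast
  qed
  show "subspace (?T p)" using flat[OF p] by metis
  obtain U where U: "openin X U" "p \<in> U" "subtopology X U = top_of_set U"
    "openin (top_of_set ((+) p ` ?T p)) U" "\<And>u. u \<in> U \<Longrightarrow> ?T u \<subseteq> ?T p"
    using flat[OF p] by metis
  have "?T u = ?T p" if "u \<in> U" for u
  proof (rule subspace_dim_equal)
    have "u \<in> topspace X" using openin_subset[OF U(1)] that by blast
    then have "subspace (?T u)" "dim (?T u) = m" "subspace (?T p)" "dim (?T p) = m"
      using flat p by metis+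
    then show "subspace (?T u)" "subspace (?T p)" "dim (?T u) \<ge> dim (?T p)" by auto
    show "?T u \<subseteq> ?T p" by (rule U(5)[OF that])
  qed
  with U show "\<exists>U. openin X U \<and> p \<in> U \<and> subtopology X U = top_of_set U
      \<and> openin (top_of_set ((+) p ` ?T p)) U \<and> (\<forall>q\<in>U. ?T q = ?T p)" by blast
qed

text \<open>Connectedness turns the local flatness into a global one, and completeness fills the
  whole affine space.\<close>

theorem complete_totally_geodesic_is_affine:
  fixes X :: "'a::euclidean_space topology"
  assumes X: "submanifold X m" "geodesically_complete X" "totally_geodesic X" "connected_space X"
    and p: "p \<in> topspace X"
  shows "subspace (tangent_space X p)" and "topspace X = (+) p ` tangent_space X p"
    and "X = top_of_set (topspace X)"
proof -
  let ?T = "tangent_space X"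
  note sub = submanifold_tangent_locally_constant(1)[OF X(1-3)]
  note loc = submanifold_tangent_locally_constant(2)[OF X(1-3)]
  show "subspace (?T p)" by (rule sub[OF p])
  \<comment> \<open>Membership in \<open>E\<close> is locally constant. Equality of tangent spaces
    is included since a step inside a flat neighbourhood of \<open>q\<close> is a vector of the
    tangent space at \<open>q\<close>.\<close>
  define E where "E = {q \<in> topspace X. q - p \<in> ?T p \<and> ?T q = ?T p}"
  have "\<exists>U. openin X U \<and> q \<in> U \<and> (\<forall>u\<in>U. u \<in> E \<longleftrightarrow> q \<in> E)" if q: "q \<in> topspace X" for q
  proof -
    obtain U where U: "openin X U" "q \<in> U" "openin (top_of_set ((+) q ` ?T q)) U" "\<And>u. u \<in> U \<Longrightarrow> ?T u = ?T q"
      using loc[OF q] by metis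
    have "u \<in> E \<longleftrightarrow> q \<in> E" if u: "u \<in> U" for u
    proof -
      have "u \<in> topspace X" using openin_subset[OF U(1)] u by blast
      obtain v where v: "v \<in> ?T q" "u = q + v" using openin_imp_subset[OF U(3)] u by auto
      have "u - p \<in> ?T p \<longleftrightarrow> q - p \<in> ?T p" if "?T q = ?T p"
      proof -
        have "u - p = (q - p) + v" "q - p = (u - p) - v" using v by auto
        then show ?thesis using subspace_add[OF sub[OF p]] subspace_diff[OF sub[OF p]] v(1) that by metis
      qed
      then show ?thesis using U(4)[OF u] \<open>u \<in> topspace X\<close> q by (auto simp: E_def)
    qed
    then show ?thesis using U by blast
  qed
  note nb = this
  have "openin X E"
  proof (subst openin_subopen, intro ballI)
    fix q assume q: "q \<in> E"
    then have "q \<in> topspace X" by (simp add: E_def)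
    from nb[OF this] q show "\<exists>U. openin X U \<and> q \<in> U \<and> U \<subseteq> E" by blast
  qed
  moreover have "openin X (topspace X - E)"
  proof (subst openin_subopen, intro ballI)
    fix q assume q: "q \<in> topspace X - E"
    then obtain U where U: "openin X U" "q \<in> U" "\<forall>u\<in>U. u \<in> E \<longleftrightarrow> q \<in> E" using nb[of q] by blast
    then have "U \<subseteq> topspace X - E" using openin_subset[OF U(1)] q by blast
    then show "\<exists>U. openin X U \<and> q \<in> U \<and> U \<subseteq> topspace X - E" using U by blast
  qed
  moreover have "E \<subseteq> topspace X" unfolding E_def by blast
  ultimately have "E = {} \<or> E = topspace X"
    using X(4) unfolding connected_space_clopen_in closedin_def by blast
  moreover have "p \<in> E" using p subspace_0[OF sub[OF p]] by (simp add: E_def)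
  ultimately have E: "E = topspace X" by blast
  show aff: "topspace X = (+) p ` ?T p"
  proof
    show "topspace X \<subseteq> (+) p ` ?T p"
    proof
      fix q assume "q \<in> topspace X"
      then have "q - p \<in> ?T p" using E by (auto simp: E_def)
      then show "q \<in> (+) p ` ?T p" by (intro image_eqI[of _ _ "q - p"]) auto
    qed
    show "(+) p ` ?T p \<subseteq> topspace X"
    proof
      fix q assume "q \<in> (+) p ` ?T p"
      then obtain v where v: "v \<in> ?T p" "q = p + v" by blast
      have "p + 1 *\<^sub>R v \<in> topspace X"
        using continuous_map_tangent_line[OF X(2,3) p v(1)]
        unfolding continuous_map_def Pi_iff by (metis UNIV_I topspace_euclidean)
      then show "q \<in> topspace X" using v by simp
    qed
  qed
  have aff': "topspace X = (+) q ` ?T q" if q: "q \<in> topspace X" for q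
  proof -
    have qE: "q - p \<in> ?T p" "?T q = ?T p" using q E by (auto simp: E_def)
    have "(+) p ` ?T p = (+) q ` ?T p"
    proof (intro equalityI subsetI)
      fix x assume "x \<in> (+) p ` ?T p"
      then obtain v where "v \<in> ?T p" "x = p + v" by blast
      then show "x \<in> (+) q ` ?T p"
        using subspace_diff[OF sub[OF p] _ qE(1)] by (intro image_eqI[of _ _ "v - (q - p)"]) auto
    next
      fix x assume "x \<in> (+) q ` ?T p"
      then obtain v where "v \<in> ?T p" "x = q + v" by blast
      then show "x \<in> (+) p ` ?T p"
        using subspace_add[OF sub[OF p] qE(1)] by (intro image_eqI[of _ _ "(q - p) + v"]) auto
    qed
    then show ?thesis using aff qE by simp
  qed
  \<comment> \<open>By \<open>aff'\<close>, every point has a neighbourhood that is open in both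
    topologies and on which they coincide.\<close>
  show "X = top_of_set (topspace X)"
  proof (rule topology_eq[THEN iffD2], intro allI)
    fix V
    have *: "\<exists>U. openin X U \<and> q \<in> U \<and> subtopology X U = top_of_set U \<and> openin (top_of_set (topspace X)) U"
      if "q \<in> topspace X" for q
      using loc[OF that] aff'[OF that] by metis
    show "openin X V \<longleftrightarrow> openin (top_of_set (topspace X)) V"
    proof
      assume V: "openin X V"
      show "openin (top_of_set (topspace X)) V"
      proof (subst openin_subopen, intro ballI)
        fix q assume q: "q \<in> V"
        then obtain U where U: "openin X U" "q \<in> U" "subtopology X U = top_of_set U"
          "openin (top_of_set (topspace X)) U" using * openin_subset[OF V] by blast
        have "openin (subtopology X U) (U \<inter> V)" using V by (simp add: openin_subtopology_Int2)
        then have "openin (top_of_set (topspace X)) (U \<inter> V)"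
          unfolding U(3) using U(4) openin_trans by blast
        then show "\<exists>T. openin (top_of_set (topspace X)) T \<and> q \<in> T \<and> T \<subseteq> V" using q U(2) by blast
      qed
    next
      assume V: "openin (top_of_set (topspace X)) V"
      show "openin X V"
      proof (subst openin_subopen, intro ballI)
        fix q assume q: "q \<in> V"
        then obtain U where U: "openin X U" "q \<in> U" "subtopology X U = top_of_set U"
          "openin (top_of_set (topspace X)) U" using * openin_imp_subset[OF V] by blast
        obtain V' where V': "open V'" "V = topspace X \<inter> V'" using V unfolding openin_open by blast
        have "U \<inter> V = U \<inter> V'" using V' openin_subset[OF U(1)] by blast
        then have "openin (subtopology X U) (U \<inter> V)"
          unfolding U(3) using V'(1) by (simp add: openin_open_Int)
        then have "openin X (U \<inter> V)" using U(1) by (simp add: openin_open_subtopology)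
        then show "\<exists>T. openin X T \<and> q \<in> T \<and> T \<subseteq> V" using q U(2) by blast
      qed
    qed
  qed
qed


section \<open>The image of an orthogonal representation\<close>

text \<open>For a convergent sequence \<open>a n \<star> x n\<close>, compactness gives a
  subsequence of \<open>a n\<close> with a limit in \<open>K\<close>, and then the corresponding
  \<open>x n\<close> converge as well. This yields the quotient topology on the orbit space from
  closed subsets of the section.\<close>

lemma (in compact_isometry_group) closed_saturation:
  assumes "closed C"
  shows "closed (\<Union>a\<in>K. (\<star>) a ` C)"
  unfolding closed_sequential_limits
proof (intro allI impI, elim conjE)
  fix y l assume y: "\<forall>n. y n \<in> (\<Union>a\<in>K. (\<star>) a ` C)" and lim: "y \<longlonglongrightarrow> l"
  then have "\<exists>a x. a \<in> K \<and> x \<in> C \<and> y n = a \<star> x" for n by blast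
  then obtain a x where ax: "\<And>n. a n \<in> K" "\<And>n. x n \<in> C" "\<And>n. y n = a n \<star> x n" by metis
  obtain r b where r: "strict_mono r" and b: "b \<in> K" and ab: "(\<lambda>n. a (r n)) \<longlonglongrightarrow> b"
    using convergent_subsequence[of a, OF ax(1)] by blast
  obtain b' where b': "b' \<in> K" "\<And>x. b \<star> b' \<star> x = x" using obtain_inverse[OF b] by metis
  have yr: "(\<lambda>n. y (r n)) \<longlonglongrightarrow> l"
    using LIMSEQ_subseq_LIMSEQ[OF lim r] by (simp add: comp_def)
  have "norm (x (r n) - b' \<star> l) = norm (y (r n) - a (r n) \<star> b' \<star> l)" for n
    using norm_apply[OF ax(1), of "r n" "x (r n) - b' \<star> l"] by (simp add: ax(3) endo_simps)
  moreover have "(\<lambda>n. norm (y (r n) - a (r n) \<star> b' \<star> l)) \<longlonglongrightarrow> norm (l - b \<star> b' \<star> l)"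
    by (intro tendsto_intros endo_tendsto yr ab)
  ultimately have "(\<lambda>n. norm (x (r n) - b' \<star> l)) \<longlonglongrightarrow> 0" by (simp add: b'(2))
  then have "(\<lambda>n. x (r n)) \<longlonglongrightarrow> b' \<star> l"
    by (rule LIM_zero_cancel[OF tendsto_norm_zero_cancel])
  then have "b' \<star> l \<in> C" by (rule closed_sequentially[OF assms ax(2)])
  then show "l \<in> (\<Union>a\<in>K. (\<star>) a ` C)" using b b'(2)[of l] by (metis UN_I imageI)
qed

definition endo_of_linear :: "('a::euclidean_space \<Rightarrow> 'a) \<Rightarrow> 'a endo" where
  "endo_of_linear f = endo_of_blinfun (Blinfun f)"

lemma endo_of_linear_apply: "linear f \<Longrightarrow> endo_of_linear f \<star> x = f x"
  by (simp add: endo_of_linear_def endo_apply.rep_eq endo_of_blinfun_inverse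
      bounded_linear_Blinfun_apply linear_conv_bounded_linear)

lemma endo_eqI: "(\<And>x. a \<star> x = b \<star> x) \<Longrightarrow> a = b"
  by transfer (rule blinfun_eqI)

text \<open>The rank-one summands depend only on the vectors \<open>f i\<close>, so continuity of
  the representation at single vectors gives continuity in the operator norm.\<close>

lemma endo_of_linear_eq_sum:
  fixes f :: "'a::euclidean_space \<Rightarrow> 'a"
  assumes "linear f"
  shows "endo_of_linear f = (\<Sum>i\<in>Basis. endo_of_linear (\<lambda>x. (x \<bullet> i) *\<^sub>R f i))"
proof (rule endo_eqI)
  fix x
  have lin: "linear (\<lambda>x. (x \<bullet> i) *\<^sub>R f i)" for i
    by (intro bounded_linear.linear bounded_linear_scaleR_left[THEN bounded_linear_compose]
        bounded_linear_inner_left)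
  have "endo_of_linear f \<star> x = f (\<Sum>i\<in>Basis. (x \<bullet> i) *\<^sub>R i)"
    by (simp add: endo_of_linear_apply assms euclidean_representation)
  also have "\<dots> = (\<Sum>i\<in>Basis. (x \<bullet> i) *\<^sub>R f i)"
    by (simp add: linear_sum[OF assms] linear_scale[OF assms])
  finally show "endo_of_linear f \<star> x = (\<Sum>i\<in>Basis. endo_of_linear (\<lambda>x. (x \<bullet> i) *\<^sub>R f i)) \<star> x"
    by (simp add: endo.sum_left endo_of_linear_apply lin)
qed

lemma continuous_on_endo_rank_one:
  "continuous_on UNIV (\<lambda>v::'a::euclidean_space. endo_of_linear (\<lambda>x. (x \<bullet> i) *\<^sub>R v))"
proof -
  have lin: "linear (\<lambda>x. (x \<bullet> i) *\<^sub>R v)" for v :: 'a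
    by (intro bounded_linear.linear bounded_linear_scaleR_left[THEN bounded_linear_compose]
        bounded_linear_inner_left)
  have "linear (\<lambda>v::'a. endo_of_linear (\<lambda>x. (x \<bullet> i) *\<^sub>R v))"
    by (rule linearI; rule endo_eqI; unfold endo.add_left endo.scaleR_left endo_of_linear_apply[OF lin])
      (simp_all add: scaleR_add_right)
  then show ?thesis by (simp add: linear_continuous_on linear_conv_bounded_linear)
qed

lemma orthogonal_representation_compact_isometry_group:
  fixes \<rho> :: "'g \<Rightarrow> 'a::euclidean_space \<Rightarrow> 'a"
  assumes T: "topspace T = carrier G" "compact_space T" and rep: "orthogonal_representation G T \<rho>"
  shows "compact_isometry_group ((\<lambda>g. endo_of_linear (\<rho> g)) ` carrier G)"
proof -
  interpret group_action G UNIV \<rho> using rep by (simp add: orthogonal_representation_def)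
  interpret group G using group_hom by (rule group_hom.axioms)
  have orth: "orthogonal_transformation (\<rho> g)" if "g \<in> carrier G" for g
    using rep that by (simp add: orthogonal_representation_def)
  have lin: "linear (\<rho> g)" if "g \<in> carrier G" for g
    using orth[OF that] by (simp add: orthogonal_transformation_def)
  note app = endo_of_linear_apply[OF lin]
  have one: "\<rho> \<one>\<^bsub>G\<^esub> x = x" for x using id_eq_one by (metis UNIV_I restrict_apply)
  let ?K = "(\<lambda>g. endo_of_linear (\<rho> g)) ` carrier G"
  show ?thesis
  proof
    have "continuous_map T euclidean (\<lambda>g. \<rho> g v)" for v
    proof -
      have "continuous_map T (prod_topology T euclidean) (\<lambda>g. (g, v))"
        by (intro continuous_map_pairedI) auto
      from continuous_map_compose[OF this] rep show ?thesis
        by (fastforce simp: orthogonal_representation_def comp_def)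
    qed
    then have "continuous_map T euclidean (\<lambda>g. endo_of_linear (\<lambda>x. (x \<bullet> i) *\<^sub>R \<rho> g i))" for i
      using continuous_map_compose[of T euclidean "\<lambda>g. \<rho> g i" euclidean,
          OF _ continuous_map_iff_continuous2[THEN iffD2, OF continuous_on_endo_rank_one[of i]]]
      by (simp add: comp_def)
    then have "continuous_map T euclidean (\<lambda>g. \<Sum>i\<in>Basis. endo_of_linear (\<lambda>x. (x \<bullet> i) *\<^sub>R \<rho> g i))"
      by (intro continuous_map_sum finite_Basis)
    then have "continuous_map T euclidean (\<lambda>g. endo_of_linear (\<rho> g))"
      by (rule continuous_map_eq) (simp add: T endo_of_linear_eq_sum[OF lin])
    then show "compact ?K"
      using image_compactin[of T "topspace T" euclidean] T by (simp add: compact_space_def)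
    show "1 \<in> ?K"
      by (intro image_eqI[of _ _ "\<one>\<^bsub>G\<^esub>"] endo_eqI) (simp_all add: app one)
    show "a * b \<in> ?K" if "a \<in> ?K" "b \<in> ?K" for a b
    proof -
      obtain g h where gh: "g \<in> carrier G" "h \<in> carrier G" "a = endo_of_linear (\<rho> g)" "b = endo_of_linear (\<rho> h)"
        using \<open>a \<in> ?K\<close> \<open>b \<in> ?K\<close> by blast
      then show ?thesis
        by (intro image_eqI[of _ _ "g \<otimes>\<^bsub>G\<^esub> h"] endo_eqI) (simp_all add: app endo_mult composition_rule)
    qed
    show "\<exists>b\<in>?K. a * b = 1 \<and> b * a = 1" if "a \<in> ?K" for a
    proof -
      obtain g where g: "g \<in> carrier G" "a = endo_of_linear (\<rho> g)" using \<open>a \<in> ?K\<close> by blast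
      have inv: "\<rho> (inv\<^bsub>G\<^esub> g) (\<rho> g x) = x" "\<rho> g (\<rho> (inv\<^bsub>G\<^esub> g) x) = x" for x
        using g(1) composition_rule[of x "inv\<^bsub>G\<^esub> g" g] composition_rule[of x g "inv\<^bsub>G\<^esub> g"] by (simp_all add: one)
      have "inv\<^bsub>G\<^esub> g \<in> carrier G" using g(1) by simp
      then show ?thesis
        using g inv
        by (intro bexI[of _ "endo_of_linear (\<rho> (inv\<^bsub>G\<^esub> g))"] conjI endo_eqI) (simp_all add: app endo_mult)
    qed
    show "norm (a \<star> x) = norm x" if "a \<in> ?K" for a x
      using that orth by (auto simp: app orthogonal_transformation)
  qed
qed


section \<open>Sections as linear subspaces\<close>

text \<open>The section is affine and meets the orbit of \<open>0\<close>, which is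
  \<open>{0}\<close>, so it is a linear subspace containing its own tangent spaces. The normal
  spaces are translated by \<open>orbit_velocity\<close>.\<close>

lemma k_section_linear_section:
  fixes \<rho> :: "'g \<Rightarrow> 'a::euclidean_space \<Rightarrow> 'a"
  assumes T: "topspace T = carrier G" "compact_space T" and rep: "orthogonal_representation G T \<rho>"
    and sec: "k_section G \<rho> k X"
  shows "linear_section ((\<lambda>g. endo_of_linear (\<rho> g)) ` carrier G) (topspace X)"
    and "X = top_of_set (topspace X)"
proof -
  let ?K = "(\<lambda>g. endo_of_linear (\<rho> g)) ` carrier G"
  interpret group_action G UNIV \<rho> using rep by (simp add: orthogonal_representation_def)
  interpret group G using group_hom by (rule group_hom.axioms)
  interpret K: compact_isometry_group ?K
    by (rule orthogonal_representation_compact_isometry_group[OF T rep])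
  have lin: "linear (\<rho> g)" if "g \<in> carrier G" for g
    using rep that by (simp add: orthogonal_representation_def orthogonal_transformation_def)
  note app = endo_of_linear_apply[OF lin]
  obtain m where X: "submanifold X m" "geodesically_complete X" "totally_geodesic X" "connected_space X"
    using sec by (auto simp: k_section_def)
  have meets: "\<exists>g\<in>carrier G. \<rho> g v \<in> topspace X" for v
    using sec by (auto simp: k_section_def orbit_def)
  have zero: "0 \<in> topspace X" using meets[of 0] lin linear_0 by metis
  note affine = complete_totally_geodesic_is_affine[OF X]
  show "X = top_of_set (topspace X)" by (rule affine(3)[OF zero])
  have X0: "topspace X = tangent_space X 0" using affine(2)[OF zero] by simp
  have sub: "subspace (topspace X)" using affine(1)[OF zero] X0 by simp
  have tangent: "tangent_space X z \<subseteq> topspace X" if z: "z \<in> topspace X" for z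
  proof
    fix v assume "v \<in> tangent_space X z"
    then have "z + v \<in> topspace X" using affine(2)[OF z] by blast
    then show "v \<in> topspace X" using subspace_diff[OF sub _ z] by fastforce
  qed
  have regular: "regular_point G \<rho> z" if "K.regular z" for z
    unfolding regular_point_def
  proof
    fix q
    obtain c where c: "c \<in> carrier G" "K.stab z \<subseteq> K.stab (endo_of_linear (\<rho> c) \<star> q)"
      using \<open>K.regular z\<close> unfolding K.regular_def by blast
    have "inv\<^bsub>G\<^esub> c \<otimes>\<^bsub>G\<^esub> h \<otimes>\<^bsub>G\<^esub> inv\<^bsub>G\<^esub> (inv\<^bsub>G\<^esub> c) \<in> stabilizer G \<rho> q" if "h \<in> stabilizer G \<rho> z" for h
    proof -
      have h: "h \<in> carrier G" "\<rho> h z = z" using that by (auto simp: stabilizer_def)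
      then have "endo_of_linear (\<rho> h) \<in> K.stab z" by (simp add: K.stab_def app)
      then have "endo_of_linear (\<rho> h) \<in> K.stab (endo_of_linear (\<rho> c) \<star> q)" using c(2) by blast
      then have "\<rho> h (\<rho> c q) = \<rho> c q" using c(1) h(1) by (simp add: K.stab_def app)
      moreover have "\<rho> (inv\<^bsub>G\<^esub> c) (\<rho> c q) = q" using c(1) by (intro orbit_sym_aux) auto
      ultimately show ?thesis
        using h(1) c(1) by (simp add: stabilizer_def composition_rule)
    qed
    then show "\<exists>g\<in>carrier G. (\<lambda>h. g \<otimes>\<^bsub>G\<^esub> h \<otimes>\<^bsub>G\<^esub> inv\<^bsub>G\<^esub> g) ` stabilizer G \<rho> z \<subseteq> stabilizer G \<rho> q"
      using c(1) by (intro bexI[of _ "inv\<^bsub>G\<^esub> c"]) auto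
  qed
  show "linear_section ?K (topspace X)"
  proof
    show "subspace (topspace X)" by (rule sub)
    show "\<exists>a\<in>?K. a \<star> v \<in> topspace X" for v using meets[of v] by (auto simp: app)
    show "(\<star>) a ` topspace X = topspace X"
      if "z \<in> topspace X" "K.regular z" "a \<in> ?K" "a \<star> z \<in> topspace X" for z a
    proof -
      obtain g where g: "g \<in> carrier G" "a = endo_of_linear (\<rho> g)" using \<open>a \<in> ?K\<close> by blast
      then have "(\<star>) a = \<rho> g" by (auto simp: app)
      moreover have "\<rho> g ` topspace X = topspace X"
        using sec regular[OF that(2)] that(1,4) g app[OF g(1)] unfolding k_section_def by metis
      ultimately show ?thesis by simp
    qed
    show "y \<in> topspace X"
      if z: "z \<in> topspace X" "K.regular z" and perp: "\<And>A. A \<in> K.lie \<Longrightarrow> (A \<star> z) \<bullet> y = 0" for z y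
    proof -
      \<comment> \<open>A tangent vector of the orbit has the form \<open>A \<star> z\<close> with
        \<open>A\<close> in the Lie algebra, so orthogonality to these vectors implies
        normality.\<close>
      have "v \<bullet> y = 0" if v: "v \<in> tangent_space (top_of_set (orbit G \<rho> z)) z" for v
      proof -
        obtain \<gamma> I where \<gamma>: "v = vector_derivative \<gamma> (at 0)" "smooth_curve (top_of_set (orbit G \<rho> z)) I \<gamma>"
          "0 \<in> I" "\<gamma> 0 = z" using v unfolding tangent_space_def by blast
        have "open I" using \<gamma>(2) by (simp add: smooth_curve_def)
        then obtain e where e: "e > 0" "ball 0 e \<subseteq> I" using \<gamma>(3) open_contains_ball by blast
        have "\<gamma> ` I \<subseteq> orbit G \<rho> z"
          using \<gamma>(2) unfolding smooth_curve_def continuous_map_subtopology_eu[of I] by auto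
        then have "\<exists>g\<in>?K. \<gamma> t = g \<star> \<gamma> 0" if "\<bar>t\<bar> < e" for t
          using that e(2) unfolding \<gamma>(4) by (force simp: orbit_def app)
        then obtain A where "A \<in> K.lie" "v = A \<star> z"
          using K.orbit_velocity[OF smooth_curve_has_vector_derivative[OF \<gamma>(2,3)] e(1)] \<gamma>(1,4) by metis
        then show ?thesis using perp by simp
      qed
      then have "y \<in> normal_space (top_of_set (orbit G \<rho> z)) z"
        by (simp add: normal_space_def orthogonal_comp_def orthogonal_def)
      then show ?thesis
        using sec z(1) regular[OF z(2)] tangent[OF z(1)] unfolding k_section_def by blast
    qed
  qed
qed


section \<open>The homeomorphism of orbit spaces\<close>

text \<open>On the section, \<open>orbit G \<rho>\<close> is a quotient map onto the orbit space of
  the whole representation, and its fibres are the orbits of the stabilizer. The induced map is thus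
  an injective quotient map.\<close>

theorem theorem9:
  fixes G :: "('g, 'm) monoid_scheme"
    and T :: "'g topology"
    and L :: "'e::euclidean_space set"
    and \<A> :: "('g set \<times> ('g \<Rightarrow> 'e)) set"
    and \<rho> :: "'g \<Rightarrow> 'a::euclidean_space \<Rightarrow> 'a"
    and X :: "'a topology"
    and k :: nat
  assumes "lie_group G T L \<A>" and "compact_space T"
    and "orthogonal_representation G T \<rho>"
    and "k_section G \<rho> k X"
  shows "\<exists>f. homeomorphic_map
               (orbit_space (G\<lparr>carrier := set_stabilizer G \<rho> (topspace X)\<rparr>) \<rho> X)
               (orbit_space G \<rho> euclidean) f \<and>
             (\<forall>x\<in>topspace X. f (orbit (G\<lparr>carrier := set_stabilizer G \<rho> (topspace X)\<rparr>) \<rho> x) = orbit G \<rho> x)"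
proof -
  define H where "H = G\<lparr>carrier := set_stabilizer G \<rho> (topspace X)\<rparr>"
  let ?K = "(\<lambda>g. endo_of_linear (\<rho> g)) ` carrier G"
  interpret group_action G UNIV \<rho> using assms(3) by (simp add: orthogonal_representation_def)
  interpret group G using group_hom by (rule group_hom.axioms)
  have T: "topspace T = carrier G" using assms(1) by (simp add: lie_group_def)
  note sec = k_section_linear_section[OF T assms(2-4)]
  interpret linear_section ?K "topspace X" by (rule sec(1))
  have lin: "linear (\<rho> g)" if "g \<in> carrier G" for g
    using assms(3) that by (simp add: orthogonal_representation_def orthogonal_transformation_def)
  note app = endo_of_linear_apply[OF lin]
  have one: "\<rho> \<one>\<^bsub>G\<^esub> x = x" for x using id_eq_one by (metis UNIV_I restrict_apply)
  have orbit_eq: "orbit G \<rho> y = orbit G \<rho> x" if "y \<in> orbit G \<rho> x" for x y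
    using orbit_trans[of x y] orbit_trans[of y x] orbit_sym[of x y] that by blast
  have H_sub: "orbit H \<rho> x \<subseteq> orbit G \<rho> x" for x
    by (auto simp: orbit_def H_def set_stabilizer_def)
  have H_refl: "x \<in> orbit H \<rho> x" for x
    unfolding orbit_def H_def set_stabilizer_def using one by (auto intro!: exI[of _ "\<one>\<^bsub>G\<^esub>"] simp: image_def)
  have H_orbit: "y \<in> orbit H \<rho> x"
    if xy: "x \<in> topspace X" "y \<in> topspace X" "y \<in> orbit G \<rho> x" for x y
  proof -
    obtain g where g: "g \<in> carrier G" "y = \<rho> g x" using xy(3) by (auto simp: orbit_def)
    have "endo_of_linear (\<rho> g) \<in> ?K" "endo_of_linear (\<rho> g) \<star> x \<in> topspace X"
      using g xy(2) by (simp_all add: app)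
    from orbit_eq_stabilizer_orbit[OF xy(1) this]
    obtain a where a: "a \<in> ?K" "(\<star>) a ` topspace X = topspace X" "a \<star> x = y"
      using g by (metis app)
    obtain h where h: "h \<in> carrier G" "a = endo_of_linear (\<rho> h)" using a(1) by blast
    then have "(\<star>) a = \<rho> h" by (auto simp: app)
    then show ?thesis using a h by (auto simp: orbit_def H_def set_stabilizer_def)
  qed
  have H_trans: "orbit H \<rho> y \<subseteq> orbit H \<rho> x" if y: "y \<in> orbit H \<rho> x" for x y
  proof
    fix w assume "w \<in> orbit H \<rho> y"
    then obtain g h where gh: "g \<in> carrier G" "\<rho> g ` topspace X = topspace X" "w = \<rho> g y"
      "h \<in> carrier G" "\<rho> h ` topspace X = topspace X" "y = \<rho> h x"
      using y by (auto simp: orbit_def H_def set_stabilizer_def)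
    have comp: "\<rho> (g \<otimes>\<^bsub>G\<^esub> h) v = \<rho> g (\<rho> h v)" for v using gh by (simp add: composition_rule)
    have "\<rho> (g \<otimes>\<^bsub>G\<^esub> h) ` topspace X = \<rho> g ` (\<rho> h ` topspace X)" by (simp add: comp image_image)
    then have "g \<otimes>\<^bsub>G\<^esub> h \<in> set_stabilizer G \<rho> (topspace X)"
      using gh by (simp add: set_stabilizer_def)
    moreover have "w = \<rho> (g \<otimes>\<^bsub>G\<^esub> h) x" by (simp only: gh(3,6) comp)
    ultimately show "w \<in> orbit H \<rho> x" by (auto simp: orbit_def H_def)
  qed
  \<comment> \<open>All points of an orbit of \<open>H\<close> have the same orbit under
    \<open>G\<close>, so the union is that single orbit and no representative has to be
    chosen.\<close>
  define f where "f = (\<lambda>P. \<Union>x\<in>P. orbit G \<rho> x)"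
  have f: "f (orbit H \<rho> x) = orbit G \<rho> x" for x
    unfolding f_def using H_refl H_sub orbit_eq by blast
  have quotient: "quotient_map X (orbit_space G \<rho> euclidean) (orbit G \<rho>)"
    unfolding quotient_map_def topspace_orbit_space
  proof (intro conjI allI impI)
    show "orbit G \<rho> ` topspace X = orbits G (topspace euclidean) \<rho>"
    proof
      show "orbits G (topspace euclidean) \<rho> \<subseteq> orbit G \<rho> ` topspace X"
      proof
        fix P assume "P \<in> orbits G (topspace euclidean) \<rho>"
        then obtain v where v: "P = orbit G \<rho> v" by (auto simp: orbits_def)
        obtain a where "a \<in> ?K" "a \<star> v \<in> topspace X" using meets by blast
        then obtain g where "g \<in> carrier G" "\<rho> g v \<in> topspace X" by (auto simp: app)
        moreover from this have "\<rho> g v \<in> orbit G \<rho> v" by (auto simp: orbit_def)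
        ultimately show "P \<in> orbit G \<rho> ` topspace X"
          unfolding v using orbit_eq by blast
      qed
    qed (auto simp: orbits_def)
    fix U assume U: "U \<subseteq> orbits G (topspace (euclidean :: 'a topology)) \<rho>"
    define C where "C = {x \<in> topspace X. orbit G \<rho> x \<notin> U}"
    \<comment> \<open>The complement of the preimage of \<open>U\<close> in the whole space is swept
      out by its part \<open>C\<close> in the section, so it is closed as soon as \<open>C\<close>
      is.\<close>
    have saturation: "(\<Union>a\<in>?K. (\<star>) a ` C) = - {x. orbit G \<rho> x \<in> U}"
    proof (intro equalityI subsetI)
      fix y assume "y \<in> (\<Union>a\<in>?K. (\<star>) a ` C)"
      then obtain g x where gx: "g \<in> carrier G" "x \<in> C" "y = \<rho> g x" by (auto simp: app)
      then have "y \<in> orbit G \<rho> x" by (auto simp: orbit_def)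
      then have "orbit G \<rho> y = orbit G \<rho> x" by (rule orbit_eq)
      then show "y \<in> - {x. orbit G \<rho> x \<in> U}" using gx(2) by (simp add: C_def)
    next
      fix y assume y: "y \<in> - {x. orbit G \<rho> x \<in> U}"
      obtain a where a: "a \<in> ?K" "a \<star> y \<in> topspace X" using meets by blast
      obtain b where b: "b \<in> ?K" "b \<star> a \<star> y = y" using obtain_inverse[OF a(1)] by metis
      have "a \<star> y \<in> orbit G \<rho> y" using a(1) by (auto simp: orbit_def app)
      then have "orbit G \<rho> (a \<star> y) = orbit G \<rho> y" by (rule orbit_eq)
      then have "a \<star> y \<in> C" using a(2) y by (simp add: C_def)
      then show "y \<in> (\<Union>a\<in>?K. (\<star>) a ` C)" using b by (metis UN_I imageI)
    qed
    show "openin X {x \<in> topspace X. orbit G \<rho> x \<in> U} \<longleftrightarrow> openin (orbit_space G \<rho> euclidean) U"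
    proof
      assume "openin X {x \<in> topspace X. orbit G \<rho> x \<in> U}"
      then have "openin (top_of_set (topspace X)) (topspace X - C)"
        using sec(2) by (simp add: C_def set_diff_eq conj_commute cong: conj_cong)
      then have "closedin (top_of_set (topspace X)) C"
        by (simp add: closedin_def) (auto simp: C_def)
      then have "closed C"
        using closedin_closed_trans closed_subspace[OF subspace] by blast
      then have "closed (- {x. orbit G \<rho> x \<in> U})"
        unfolding saturation[symmetric] by (rule closed_saturation)
      then show "openin (orbit_space G \<rho> euclidean) U"
        using U by (simp add: openin_orbit_space open_closed)
    next
      assume "openin (orbit_space G \<rho> euclidean) U"
      then have "open {x. orbit G \<rho> x \<in> U}" by (simp add: openin_orbit_space)
      then have "openin (top_of_set (topspace X)) (topspace X \<inter> {x. orbit G \<rho> x \<in> U})"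
        by (rule openin_open_Int)
      then show "openin X {x \<in> topspace X. orbit G \<rho> x \<in> U}"
        using sec(2) by (simp add: Int_def)
    qed
  qed
  have "quotient_map X (orbit_space G \<rho> euclidean) (f \<circ> orbit H \<rho>)"
    using quotient by (simp add: comp_def f)
  then have "quotient_map (orbit_space H \<rho> X) (orbit_space G \<rho> euclidean) f"
    using quotient_map_compose_eq[OF quotient_map_orbit_space] by blast
  moreover have "inj_on f (topspace (orbit_space H \<rho> X))"
  proof (rule inj_onI)
    fix P Q assume "P \<in> topspace (orbit_space H \<rho> X)" "Q \<in> topspace (orbit_space H \<rho> X)" and eq: "f P = f Q"
    then obtain x y where xy: "x \<in> topspace X" "y \<in> topspace X" "P = orbit H \<rho> x" "Q = orbit H \<rho> y"
      by (auto simp: topspace_orbit_space orbits_def)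
    then have "orbit G \<rho> x = orbit G \<rho> y" using eq by (simp add: f)
    then have "x \<in> orbit G \<rho> y" "y \<in> orbit G \<rho> x" using H_refl H_sub by blast+
    then show "P = Q" using H_trans H_orbit xy by blast
  qed
  ultimately have "homeomorphic_map (orbit_space H \<rho> X) (orbit_space G \<rho> euclidean) f"
    by (simp add: homeomorphic_map_def)
  then show ?thesis using f unfolding H_def by blast
qed

end
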